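(* Let $D=(0,1)^d$ and $\mathcal{H}=L^2(D;\mathbb{C})$. Let $C:\mathcal{H}\to\mathcal{H}$ be a negative fractional power of a differential operator such that $C$ is positive, symmetric and trace-class, with eigenvectors the Fourier basis $\varphi_k(x)=e^{2\pi i k\cdot x}$, $k\in\mathbb{Z}^d$, and corresponding eigenvalues $\{\lambda_k^2\}_{k\in\mathbb{Z}^d}$. Define the Markov chain $\{u_n\}$ by $$u_{n+1}(x)=(u_n*\xi_{n+1})(x):=\int_D u_n(x-y)\,\xi_{n+1}(y)\,\mathrm{d}y,\qquad \xi_{n+1}\sim N(0,C)\ \text{i.i.d.},$$ where functions are extended periodically. Let $\gamma\approx0.577$ be the Euler--Mascheroni constant. Then for any $u_0\in\mathcal{H}$ and each $k\in\mathbb{Z}^d$, $$\lim_{n\to\infty}|\hat{u}_n(k)|^2=\begin{cases}0 & \text{if } |\lambda_k|^2<2e^\gamma,\\ \infty & \text{if } |\lambda_k|^2>2e^\gamma,\end{cases}\qquad\text{almost surely.}$$ In particular, if $|\lambda_k|^2<2e^\gamma$ for all $k\in\mathbb{Z}^d$, then every Fourier coefficient of $u_n$ tends to zero almost surely and hence $u_n\rightharpoonup0$ weakly in $\mathcal{H}$ almost surely.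
   Context: Fourier coefficients: $\hat{u}(k)=\int_D\overline{\varphi_k(x)}u(x)\,\mathrm{d}x$ for $u\in\mathcal{H}$, $k\in\mathbb{Z}^d$. Here $\xi\sim N(0,C)$ means that $\xi=\sum_{k\in\mathbb{Z}^d}\lambda_k\eta_k\varphi_k$ (Karhunen--Loève expansion) with $\eta_k\sim N(0,1)$ i.i.d. standard normal random variables; so for the i.i.d. sequence $\{\xi_n\}$ one has $\hat{\xi}_{n}(k)=\lambda_k\eta_{n,k}$ with all $\eta_{n,k}\sim N(0,1)$ independent.
   Formalization: The divergence to infinity for |λ_k|² > 2e^γ is stated only when the k-th Fourier coefficient of u_0 is nonzero; if it vanishes (e.g. u_0 = 0), the k-th coefficient of every u_n is zero and the claim as printed is false. *)

theory Defs
  imports "HOL-Probability.Probability"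
begin

text \<open>
  Elements of \<open>L\<^sup>2(D; \<complex>)\<close> are represented by functions on the whole of \<open>real ^ 'd\<close> of which only
  the values on \<open>D\<close> matter; equality in \<open>L\<^sup>2\<close> is equality almost everywhere on \<open>D\<close>.
\<close>

type_synonym 'd field = "real ^ 'd \<Rightarrow> complex"

definition unit_cube :: "(real ^ 'd::finite) set" where
  "unit_cube = {x. \<forall>i. 0 < x $ i \<and> x $ i < 1}"

definition L2D :: "'d::finite field set" where
  "L2D = {u. set_borel_measurable lborel unit_cube u \<and>
             set_integrable lborel unit_cube (\<lambda>x. (norm (u x))\<^sup>2)}"

definition L2_inner :: "'d::finite field \<Rightarrow> 'd field \<Rightarrow> complex" where
  "L2_inner u v = (LINT x:unit_cube|lborel. cnj (u x) * v x)"

definition L2_norm :: "'d::finite field \<Rightarrow> real" where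
  "L2_norm u = sqrt (LINT x:unit_cube|lborel. (norm (u x))\<^sup>2)"

definition AE_eq :: "'d::finite field \<Rightarrow> 'd field \<Rightarrow> bool" where
  "AE_eq u v \<longleftrightarrow> (AE x in lborel. x \<in> unit_cube \<longrightarrow> u x = v x)"

text \<open>Unconditional convergence in \<open>L\<^sup>2(D; \<complex>)\<close> of \<open>\<Sum>k. f k\<close> to \<open>u\<close>.\<close>

definition L2_has_sum :: "('i \<Rightarrow> 'd::finite field) \<Rightarrow> 'd field \<Rightarrow> bool" where
  "L2_has_sum f u \<longleftrightarrow> (\<forall>k. f k \<in> L2D) \<and> u \<in> L2D \<and>
     ((\<lambda>F. L2_norm (\<lambda>x. u x - (\<Sum>k\<in>F. f k x))) \<longlongrightarrow> 0) (finite_subsets_at_top UNIV)"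

definition L2_weakly_converges :: "(nat \<Rightarrow> 'd::finite field) \<Rightarrow> 'd field \<Rightarrow> bool" where
  "L2_weakly_converges u l \<longleftrightarrow> (\<forall>n. u n \<in> L2D) \<and> l \<in> L2D \<and>
     (\<forall>v\<in>L2D. (\<lambda>n. L2_inner v (u n)) \<longlonglongrightarrow> L2_inner v l)"

definition fourier_basis :: "int ^ 'd::finite \<Rightarrow> 'd field" where
  "fourier_basis k x =
     exp (2 * complex_of_real pi * \<i> * complex_of_real (\<Sum>i\<in>UNIV. real_of_int (k $ i) * x $ i))"

definition fourier_coeff :: "'d::finite field \<Rightarrow> int ^ 'd \<Rightarrow> complex" where
  "fourier_coeff u k = (LINT x:unit_cube|lborel. cnj (fourier_basis k x) * u x)"

text \<open>
  The 1-periodic extension of \<open>u\<close> restricted to \<open>D\<close>. The points with some integer coordinate form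
  a null set; the value 0 there keeps the extension Borel measurable whatever the values of \<open>u\<close>
  outside \<open>D\<close>, so that the integral below is not turned into the default value 0.
\<close>

definition periodic_ext :: "'d::finite field \<Rightarrow> 'd field" where
  "periodic_ext u x =
     (if (\<chi> i. frac (x $ i)) \<in> unit_cube then u (\<chi> i. frac (x $ i)) else 0)"

definition convolution :: "'d::finite field \<Rightarrow> 'd field \<Rightarrow> 'd field" where
  "convolution u v x = (LINT y:unit_cube|lborel. periodic_ext u (x - y) * v y)"

primrec conv_chain :: "'d::finite field \<Rightarrow> (nat \<Rightarrow> 'd field) \<Rightarrow> nat \<Rightarrow> 'd field" where
  "conv_chain u0 xi 0 = u0"
| "conv_chain u0 xi (Suc n) = convolution (conv_chain u0 xi n) (xi (Suc n))"

definition L2_bounded_operator :: "('d::finite field \<Rightarrow> 'd field) \<Rightarrow> bool" where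
  "L2_bounded_operator C \<longleftrightarrow>
     (\<forall>u\<in>L2D. C u \<in> L2D) \<and>
     (\<forall>u\<in>L2D. \<forall>v\<in>L2D. \<forall>a b.
        AE_eq (C (\<lambda>x. a * u x + b * v x)) (\<lambda>x. a * C u x + b * C v x)) \<and>
     (\<exists>B. \<forall>u\<in>L2D. L2_norm (C u) \<le> B * L2_norm u)"

definition L2_symmetric :: "('d::finite field \<Rightarrow> 'd field) \<Rightarrow> bool" where
  "L2_symmetric C \<longleftrightarrow> (\<forall>u\<in>L2D. \<forall>v\<in>L2D. L2_inner (C u) v = L2_inner u (C v))"

definition L2_positive :: "('d::finite field \<Rightarrow> 'd field) \<Rightarrow> bool" where
  "L2_positive C \<longleftrightarrow>
     (\<forall>u\<in>L2D. Im (L2_inner u (C u)) = 0 \<and> 0 \<le> Re (L2_inner u (C u)))"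

definition L2_orthonormal_basis :: "(nat \<Rightarrow> 'd::finite field) \<Rightarrow> bool" where
  "L2_orthonormal_basis e \<longleftrightarrow>
     (\<forall>n. e n \<in> L2D) \<and>
     (\<forall>m n. L2_inner (e m) (e n) = (if m = n then 1 else 0)) \<and>
     (\<forall>u\<in>L2D. (\<forall>n. L2_inner (e n) u = 0) \<longrightarrow> AE_eq u (\<lambda>x. 0))"

text \<open>
  Trace class for a positive operator: the trace \<open>\<Sum>n. \<langle>e\<^sub>n, C e\<^sub>n\<rangle>\<close> is finite for some orthonormal
  basis, equivalently for all of them. (Without positivity one would need \<open>\<bar>C\<bar>\<close> here.)
\<close>

definition L2_positive_trace_class :: "('d::finite field \<Rightarrow> 'd field) \<Rightarrow> bool" where
  "L2_positive_trace_class C \<longleftrightarrow> L2_positive C \<and>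
     (\<exists>e. L2_orthonormal_basis e \<and> summable (\<lambda>n. Re (L2_inner (e n) (C (e n)))))"

definition partial_deriv :: "'d::finite \<Rightarrow> 'd field \<Rightarrow> 'd field" where
  "partial_deriv i f x = vector_derivative (\<lambda>t. f (x + t *\<^sub>R axis i 1)) (at 0)"

text \<open>
  The differential operator \<open>\<Sum>js\<in>J. a js (x) \<cdot> \<partial>\<^sub>j\<^sub>1 \<dots> \<partial>\<^sub>j\<^sub>m\<close>, where \<open>js = [j1, \<dots>, jm]\<close> lists the
  directions of differentiation.
\<close>

definition differential_operator ::
    "'d list set \<Rightarrow> ('d list \<Rightarrow> 'd::finite field) \<Rightarrow> 'd field \<Rightarrow> 'd field" where
  "differential_operator J a f x = (\<Sum>js\<in>J. a js x * foldr partial_deriv js f x)"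

text \<open>
  \<open>C = A\<^sup>-\<^sup>s\<close> in the sense of the spectral calculus, for a differential operator \<open>A\<close> that is
  diagonal in the Fourier basis with eigenvalues \<open>\<mu> k \<ge> 0\<close>. On the kernel of \<open>A\<close>, if any, \<open>C\<close> is 0,
  because \<open>0 powr r = 0\<close>.
\<close>

definition negative_fractional_power_of_diffop :: "('d::finite field \<Rightarrow> 'd field) \<Rightarrow> bool" where
  "negative_fractional_power_of_diffop C \<longleftrightarrow>
     (\<exists>J a \<mu> s. finite J \<and> 0 < s \<and>
        (\<forall>k. 0 \<le> \<mu> k \<and>
             (\<forall>x\<in>unit_cube. differential_operator J a (fourier_basis k) x =
                            complex_of_real (\<mu> k) * fourier_basis k x)) \<and>
        (\<forall>u\<in>L2D. L2_has_sum
             (\<lambda>k x. complex_of_real (\<mu> k powr (- s)) * fourier_coeff u k * fourier_basis k x)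
             (C u)))"

text \<open>
  \<open>\<xi>\<^sub>1, \<xi>\<^sub>2, \<dots>\<close> are i.i.d. with law \<open>N(0, C)\<close>, where \<open>C\<close> has eigenvalues \<open>(lam k)\<^sup>2\<close> on the Fourier
  basis: almost surely \<open>\<xi>\<^sub>n = \<Sum>k. lam k * eta n k * fourier_basis k\<close> in \<open>L\<^sup>2(D; \<complex>)\<close>, with real
  standard normal coefficients \<open>eta n k\<close> that are independent jointly in \<open>n\<close> and \<open>k\<close>.
\<close>

definition iid_KL_gaussian ::
    "'w measure \<Rightarrow> (int ^ 'd::finite \<Rightarrow> real) \<Rightarrow> (nat \<Rightarrow> int ^ 'd \<Rightarrow> 'w \<Rightarrow> real) \<Rightarrow>
     (nat \<Rightarrow> 'w \<Rightarrow> 'd field) \<Rightarrow> bool" where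
  "iid_KL_gaussian M lam eta xi \<longleftrightarrow>
     prob_space.indep_vars M (\<lambda>_. borel) (\<lambda>(n, k). eta n k) ({1..} \<times> UNIV) \<and>
     (\<forall>n\<ge>1. \<forall>k. distributed M lborel (eta n k) std_normal_density) \<and>
     (\<forall>n\<ge>1. AE \<omega> in M.
        L2_has_sum (\<lambda>k x. complex_of_real (lam k * eta n k \<omega>) * fourier_basis k x) (xi n \<omega>))"

end

theory Submission
  imports Defs
begin

text \<open>
  Convolution multiplies Fourier coefficients, so the modulus of the \<open>k\<close>-th coefficient of
  \<open>u\<^sub>n\<close> is that of \<open>u\<^sub>0\<close> times \<open>\<Prod>j\<le>n. \<bar>\<lambda>\<^sub>k \<eta>\<^sub>j\<^sub>k\<bar>\<close>. Instead of the strong law of large numbers for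
  the logarithms we use fractional moments: \<open>p \<mapsto> ln (E \<bar>\<lambda>\<eta>\<bar>\<^sup>p)\<close> vanishes at \<open>0\<close> with derivative
  \<open>(ln \<lambda>\<^sup>2 - ln 2 - \<gamma>) / 2\<close>, so below the threshold some \<open>p > 0\<close>, and above it some
  \<open>p \<in> (-1, 0)\<close>, has \<open>E \<bar>\<lambda>\<eta>\<bar>\<^sup>p < 1\<close>. The expectations of the \<open>p\<close>-th powers of the products are
  then summable, and the products tend to \<open>0\<close>, respectively \<open>\<infinity>\<close>, almost surely.

  Convergence of all coefficients to \<open>0\<close> gives weak convergence only together with a bound on
  \<open>u\<^sub>n\<close>. By Bessel's inequality for \<open>\<xi>\<^sub>1\<close> the sum \<open>\<Sum>k. (\<lambda>\<^sub>k \<eta>\<^sub>1\<^sub>k)\<^sup>2\<close> is almost surely finite, which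
  forces \<open>\<Sum>k. \<lambda>\<^sub>k\<^sup>2 < \<infinity>\<close>. Hence \<open>\<bar>\<lambda>\<^sub>k\<bar> \<le> 1/2\<close> for all but finitely many \<open>k\<close>, and the first moments
  of the remaining coefficients are summable over \<open>n \<ge> 2\<close> and \<open>k\<close>. So the sum over \<open>k\<close> of the
  moduli of the coefficients of \<open>u\<^sub>n\<close>, which bounds \<open>\<bar>u\<^sub>n(x)\<bar>\<close> for every \<open>x\<close>, tends to \<open>0\<close> almost
  surely.
\<close>

subsection \<open>Periodic functions on the unit cube\<close>

text \<open>As a density on the whole space it keeps all Borel sets measurable, and it is a
  probability measure, so Fubini applies to its square.\<close>

definition cube_measure :: "(real ^ 'd::finite) measure" where
  "cube_measure = density lborel (indicator unit_cube)"

definition wrap :: "real ^ 'd::finite \<Rightarrow> real ^ 'd" where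
  "wrap x = (\<chi> i. frac (x $ i))"

definition int_vec :: "int ^ 'd::finite \<Rightarrow> real ^ 'd" where
  "int_vec m = (\<chi> i. real_of_int (m $ i))"

text \<open>Unlike the open cube this is an exact fundamental domain of the integer lattice; the two
  differ by a null set.\<close>

definition half_open_cube :: "(real ^ 'd::finite) set" where
  "half_open_cube = {x. \<forall>i. 0 \<le> x $ i \<and> x $ i < 1}"

lemma unit_cube_eq_box: "unit_cube = box 0 (\<chi> i. 1)"
  by (auto simp: unit_cube_def mem_box_cart)

lemma unit_cube_measurable [measurable]: "unit_cube \<in> sets borel"
  by (simp add: unit_cube_eq_box)

lemma borel_measurable_vec_iff:
  fixes f :: "'a \<Rightarrow> real ^ 'd::finite"
  shows "f \<in> borel_measurable M \<longleftrightarrow> (\<forall>i. (\<lambda>x. f x $ i) \<in> borel_measurable M)"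
  by (subst borel_measurable_euclidean_space) (auto simp: Basis_vec_def inner_axis)

lemma borel_measurable_vec_nth [measurable]: "(\<lambda>x. x $ i)
    \<in> borel_measurable (borel :: (real ^ 'd::finite) measure)"
  by (intro borel_measurable_continuous_onI continuous_intros)

lemma measurable_wrap [measurable]: "wrap \<in> borel \<rightarrow>\<^sub>M (borel :: (real ^ 'd::finite) measure)"
  unfolding borel_measurable_vec_iff wrap_def frac_def by simp

lemma half_open_cube_measurable [measurable]: "half_open_cube
    \<in> sets (borel :: (real ^ 'd::finite) measure)"
proof -
  have "{x \<in> space (borel :: (real ^ 'd) measure). \<forall>i\<in>UNIV. 0 \<le> x $ i \<and> x $ i < 1} \<in> sets borel"
    by measurable
  then show ?thesis by (simp add: half_open_cube_def)
qed

lemma wrap_idem [simp]: "wrap (wrap x) = wrap x"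
  by (simp add: wrap_def)

lemma wrap_unit_cube: "x \<in> unit_cube \<Longrightarrow> wrap x = x"
  by (auto simp: wrap_def unit_cube_def vec_eq_iff frac_eq intro: less_imp_le)

lemma wrap_add_int_vec [simp]: "wrap (x + int_vec m) = wrap x"
  by (simp add: wrap_def int_vec_def vec_eq_iff frac_def)

lemma AE_unit_cube_iff_half_open_cube:
  "AE x in lborel. x \<in> (unit_cube :: (real ^ 'd::finite) set) \<longleftrightarrow> x \<in> half_open_cube"
proof (rule AE_I')
  let ?b = "(\<chi> i. 1) :: real ^ 'd"
  have "emeasure lborel (cbox 0 ?b - box 0 ?b) =
      emeasure lborel (cbox 0 ?b) - emeasure lborel (box 0 ?b)"
    by (rule emeasure_Diff) (auto simp: box_subset_cbox emeasure_lborel_box_eq)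
  then show "cbox 0 ?b - box 0 ?b \<in> null_sets lborel"
    by (auto simp: null_sets_def emeasure_lborel_box_eq emeasure_lborel_cbox_eq)
  have "unit_cube \<subseteq> half_open_cube" "half_open_cube \<subseteq> cbox 0 ?b"
    by (simp_all add: unit_cube_def half_open_cube_def mem_box_cart subset_iff less_imp_le)
  then show "{x \<in> space lborel. \<not> (x \<in> unit_cube \<longleftrightarrow> x \<in> half_open_cube)} \<subseteq> cbox 0 ?b - box 0 ?b"
    unfolding unit_cube_eq_box by blast
qed

lemma sets_cube_measure [simp, measurable_cong]: "sets cube_measure = sets borel"
  by (simp add: cube_measure_def)

lemma space_cube_measure [simp]: "space cube_measure = UNIV"
  by (simp add: cube_measure_def)

lemma prob_space_cube_measure: "prob_space (cube_measure :: (real ^ 'd::finite) measure)"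
proof
  have "emeasure (cube_measure :: (real ^ 'd) measure) UNIV =
      emeasure lborel (unit_cube :: (real ^ 'd) set)"
    by (simp add: cube_measure_def emeasure_density)
  also have "\<dots> = 1"
    unfolding unit_cube_eq_box
    by (subst emeasure_lborel_box) (auto simp: Basis_vec_def inner_axis inner_diff_left
        prod.neutral)
  finally show "emeasure cube_measure (space (cube_measure :: (real ^ 'd) measure)) = 1" by simp
qed

interpretation cube: prob_space cube_measure
  by (rule prob_space_cube_measure)

interpretation cube2: pair_sigma_finite cube_measure cube_measure ..

section \<open>Invariance of cube integrals of periodic functions\<close>

lemma nn_integral_cube_measure:
  assumes [measurable]: "f \<in> borel_measurable borel"
  shows "(\<integral>\<^sup>+x. f x \<partial>cube_measure) = (\<integral>\<^sup>+x. indicator half_open_cube x * f x \<partial>lborel)"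
proof -
  have "(\<integral>\<^sup>+x. f x \<partial>cube_measure) = (\<integral>\<^sup>+x. indicator unit_cube x * f x \<partial>lborel)"
    unfolding cube_measure_def by (rule nn_integral_density) auto
  also have "\<dots> = (\<integral>\<^sup>+x. indicator half_open_cube x * f x \<partial>lborel)"
    using AE_unit_cube_iff_half_open_cube by (intro nn_integral_cong_AE) (auto simp: indicator_def)
  finally show ?thesis .
qed

text \<open>With \<open>\<bar>c\<bar> = 1\<close> the map \<open>x \<mapsto> t + c x\<close> covers both translations and
  reflections; the convolution needs translation invariance in \<open>x\<close> and reflection invariance in \<open>y\<close>.\<close>

lemma lborel_distr_affine_sign:
  fixes t :: "real ^ 'd::finite"
  assumes "\<bar>c\<bar> = 1"
  shows "distr lborel borel (\<lambda>x. t + c *\<^sub>R x) = lborel"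
proof -
  have "lborel = density (distr lborel borel (\<lambda>x. t + c *\<^sub>R x))
      (\<lambda>_. ennreal (\<bar>c\<bar> ^ DIM(real ^ 'd)))"
    by (rule lborel_affine) (use assms in auto)
  also have "\<dots> = distr lborel borel (\<lambda>x. t + c *\<^sub>R x)"
    by (simp only: assms power_one ennreal_1 density_1)
  finally show ?thesis by (rule sym)
qed

lemma nn_integral_lborel_affine_sign:
  fixes t :: "real ^ 'd::finite"
  assumes "\<bar>c\<bar> = 1" and [measurable]: "f \<in> borel_measurable borel"
  shows "(\<integral>\<^sup>+x. f (t + c *\<^sub>R x) \<partial>lborel) = (\<integral>\<^sup>+x. f x \<partial>lborel)"
proof -
  have "(\<integral>\<^sup>+x. f x \<partial>lborel) = (\<integral>\<^sup>+x. f x \<partial>distr lborel borel (\<lambda>x. t + c *\<^sub>R x))"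
    by (simp only: lborel_distr_affine_sign[OF assms(1)])
  also have "\<dots> = (\<integral>\<^sup>+x. f (t + c *\<^sub>R x) \<partial>lborel)"
    by (rule nn_integral_distr) auto
  finally show ?thesis by (rule sym)
qed

lemma nn_integral_count_space_indicator_unique:
  assumes "\<exists>!m. f m \<in> S"
  shows "(\<integral>\<^sup>+m. indicator S (f m) \<partial>count_space UNIV) = 1"
proof -
  obtain m where m: "f m \<in> S" "\<And>m'. f m' \<in> S \<Longrightarrow> m' = m" using assms by (elim ex1E) metis
  have "indicator S (f m') = (indicator {m} m' :: ennreal)" for m'
    using m(1) by (cases "m' = m") (auto split: split_indicator dest: m(2))
  then show ?thesis by simp
qed

text \<open>Cut \<open>S\<close> along the lattice translates of \<open>T\<close> and move each
  piece back into \<open>T\<close>: periodicity of \<open>g\<close> preserves its integral, and the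
  pieces fill \<open>T\<close> exactly once. Both operations insert or remove a sum over
  \<open>m\<close> of indicators that equals 1.\<close>

lemma nn_integral_fundamental_domain:
  fixes g :: "real ^ 'd::finite \<Rightarrow> ennreal"
  assumes [measurable]: "S \<in> sets borel" "T \<in> sets borel" "g \<in> borel_measurable borel"
    and S: "\<And>z. \<exists>!m. z + int_vec m \<in> S" and T: "\<And>z. \<exists>!m. z + int_vec m \<in> T"
    and g: "\<And>z m. g (z + int_vec m) = g z"
  shows "(\<integral>\<^sup>+x. indicator S x * g x \<partial>lborel) = (\<integral>\<^sup>+x. indicator T x * g x \<partial>lborel)"
proof -
  have T': "\<exists>!m. z - int_vec m \<in> T" for z
  proof -
    obtain m where m: "z + int_vec m \<in> T" "\<And>m'. z + int_vec m' \<in> T \<Longrightarrow> m' = m" using T by blast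
    have neg: "int_vec (- m) = - int_vec m" for m :: "int ^ 'd"
      by (simp add: int_vec_def vec_eq_iff)
    show ?thesis
    proof (rule ex1I[of _ "- m"])
      show "z - int_vec (- m) \<in> T" using m(1) by (simp add: neg)
      fix m' assume "z - int_vec m' \<in> T"
      then have "- m' = m" by (intro m(2)) (simp add: neg)
      then show "m' = - m" by auto
    qed
  qed
  have "(\<integral>\<^sup>+x. indicator S x * g x \<partial>lborel) =
        (\<integral>\<^sup>+x. (\<integral>\<^sup>+m. indicator T (x - int_vec m) * (indicator S x *
            g x) \<partial>count_space UNIV) \<partial>lborel)"
    by (simp add: nn_integral_multc nn_integral_count_space_indicator_unique[OF T'])
  also have "\<dots> = (\<integral>\<^sup>+m. (\<integral>\<^sup>+x. indicator T (x - int_vec m) * (indicator S x *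
      g x) \<partial>lborel) \<partial>count_space UNIV)"
    by (rule nn_integral_count_space_nn_integral) auto
  also have "\<dots> = (\<integral>\<^sup>+m. (\<integral>\<^sup>+x. indicator T x * (indicator S (x + int_vec m) *
      g x) \<partial>lborel) \<partial>count_space UNIV)"
  proof (rule nn_integral_cong)
    fix m :: "int ^ 'd"
    show "(\<integral>\<^sup>+x. indicator T (x - int_vec m) * (indicator S x * g x) \<partial>lborel) =
      (\<integral>\<^sup>+x. indicator T x * (indicator S (x + int_vec m) * g x) \<partial>lborel)"
      using nn_integral_lborel_affine_sign[of 1 "\<lambda>x. indicator T (x - int_vec m) * (indicator S x *
          g x)" "int_vec m"]
      by (simp add: g add.commute[of "int_vec m"])
  qed
  also have "\<dots> = (\<integral>\<^sup>+x. (\<integral>\<^sup>+m. indicator S (x + int_vec m) * (indicator T x *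
      g x) \<partial>count_space UNIV) \<partial>lborel)"
    by (subst nn_integral_count_space_nn_integral) (auto simp: mult_ac)
  also have "\<dots> = (\<integral>\<^sup>+x. indicator T x * g x \<partial>lborel)"
    by (simp add: nn_integral_multc nn_integral_count_space_indicator_unique[OF S])
  finally show ?thesis .
qed

text \<open>Coordinate by coordinate the lattice vector is forced to be a floor, up to sign; the two
  values of \<open>c\<close> give the two equivalences in \<open>tile\<close>.\<close>

lemma half_open_cube_tiling:
  fixes z t :: "real ^ 'd::finite"
  assumes "\<bar>c\<bar> = 1"
  shows "\<exists>!m. t + c *\<^sub>R (z + int_vec m) \<in> half_open_cube"
proof -
  have c: "c = 1 \<or> c = -1" using assms by linarith
  have "t + c *\<^sub>R (z + int_vec m) \<in> half_open_cube \<longleftrightarrow>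
        m = (\<chi> i. if c = 1 then - \<lfloor>t $ i + z $ i\<rfloor> else \<lfloor>t $ i - z $ i\<rfloor>)" for m :: "int ^ 'd"
  proof -
    have tile: "0 \<le> a + (b + k) \<and> a + (b + k) < 1 \<longleftrightarrow> k = - \<lfloor>a + b\<rfloor>"
        "0 \<le> a + (- b - k) \<and> a + (- b - k) < 1 \<longleftrightarrow> k = \<lfloor>a - b\<rfloor>"
      for a b :: real and k :: int
      by (rule iffI; linarith)+
    show ?thesis
      using c unfolding half_open_cube_def mem_Collect_eq vec_eq_iff
      by (elim disjE) (simp_all add: int_vec_def flip: tile)
  qed
  then show ?thesis by simp
qed

text \<open>A substitution in the full space moves the affine map from \<open>g\<close> to the
  indicator of the cube. The resulting preimage of the cube is again a fundamental domain and may be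
  exchanged for the cube.\<close>

lemma nn_integral_cube_affine_sign:
  fixes g :: "real ^ 'd::finite \<Rightarrow> ennreal"
  assumes [measurable]: "g \<in> borel_measurable borel" and g: "\<And>x. g (wrap x) = g x" and c: "\<bar>c\<bar> = 1"
  shows "(\<integral>\<^sup>+x. g (t + c *\<^sub>R x) \<partial>cube_measure) = (\<integral>\<^sup>+x. g x \<partial>cube_measure)"
proof -
  \<comment> \<open>The translation part of the inverse map; since \<open>c * c = 1\<close>, the
    inverse has the same linear part \<open>c\<close>.\<close>
  define s where "s = - c *\<^sub>R t"
  have c2: "c * c = 1" using c by (metis abs_mult_self_eq mult_1)
  have inv: "s + c *\<^sub>R (t + c *\<^sub>R x) = x" for x
    using c2 by (simp add: s_def scaleR_add_right)
  have shift: "g (z + int_vec m) = g z" for z m by (metis g wrap_add_int_vec)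
  have "(\<integral>\<^sup>+x. g (t + c *\<^sub>R x) \<partial>cube_measure) =
      (\<integral>\<^sup>+x. indicator half_open_cube x * g (t + c *\<^sub>R x) \<partial>lborel)"
    by (rule nn_integral_cube_measure) auto
  also have "\<dots> = (\<integral>\<^sup>+x. indicator half_open_cube (s + c *\<^sub>R x) * g x \<partial>lborel)"
    using nn_integral_lborel_affine_sign[OF c, of "\<lambda>x. indicator half_open_cube (s + c *\<^sub>R x) *
        g x" t]
    by (simp add: inv)
  also have "\<dots> = (\<integral>\<^sup>+x. indicator ((\<lambda>x. s + c *\<^sub>R x) -` half_open_cube) x * g x \<partial>lborel)"
    by (simp add: indicator_def)
  also have "\<dots> = (\<integral>\<^sup>+x. indicator half_open_cube x * g x \<partial>lborel)"
  proof (rule nn_integral_fundamental_domain)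
    have "(\<lambda>x. s + c *\<^sub>R x) \<in> borel \<rightarrow>\<^sub>M borel" by measurable
    from measurable_sets[OF this half_open_cube_measurable]
    show "(\<lambda>x. s + c *\<^sub>R x) -` half_open_cube \<in> sets borel" by simp
    show "\<exists>!m. z + int_vec m \<in> (\<lambda>x. s + c *\<^sub>R x) -` half_open_cube" for z
      using half_open_cube_tiling[OF c] by simp
    show "\<exists>!m. z + int_vec m \<in> half_open_cube" for z :: "real ^ 'd"
      using half_open_cube_tiling[of 1 0] by simp
  qed (auto simp: shift)
  also have "\<dots> = (\<integral>\<^sup>+x. g x \<partial>cube_measure)"
    by (rule nn_integral_cube_measure[symmetric]) auto
  finally show ?thesis .
qed

text \<open>In the form of an identity of image measures, the invariance transfers at once to
  Bochner integrals and to integrability.\<close>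

lemma distr_cube_wrap_affine_sign:
  fixes t :: "real ^ 'd::finite"
  assumes c: "\<bar>c\<bar> = 1"
  shows "distr cube_measure borel (\<lambda>x. wrap (t + c *\<^sub>R x)) = distr cube_measure borel wrap"
proof (rule measure_eqI)
  fix A :: "(real ^ 'd) set"
  assume "A \<in> sets (distr cube_measure borel (\<lambda>x. wrap (t + c *\<^sub>R x)))"
  then have [measurable]: "A \<in> sets borel" by simp
  have "(\<integral>\<^sup>+x. indicator A (wrap (t + c *\<^sub>R x)) \<partial>cube_measure) =
      (\<integral>\<^sup>+x. indicator A (wrap x) \<partial>cube_measure)"
    using nn_integral_cube_affine_sign[OF _ _ c, of "\<lambda>x. indicator A (wrap x)" t] by simp
  then show "emeasure (distr cube_measure borel (\<lambda>x. wrap (t + c *\<^sub>R x))) A =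
             emeasure (distr cube_measure borel wrap) A"
    by (simp add: nn_integral_distr flip: nn_integral_indicator)
qed auto

lemma
  fixes g :: "real ^ 'd::finite \<Rightarrow> 'b::{banach, second_countable_topology}"
  assumes [measurable]: "g \<in> borel_measurable borel" and g: "\<And>x. g (wrap x) = g x" and c: "\<bar>c\<bar> = 1"
  shows integral_cube_affine_sign: "(\<integral>x. g (t + c *\<^sub>R x) \<partial>cube_measure) = (\<integral>x. g x \<partial>cube_measure)"
    and integrable_cube_affine_sign: "integrable cube_measure (\<lambda>x. g (t + c *\<^sub>R x)) \<longleftrightarrow>
        integrable cube_measure g"
proof -
  note D = distr_cube_wrap_affine_sign[OF c, of t]
  have "(\<integral>x. g (wrap (t + c *\<^sub>R x)) \<partial>cube_measure) = (\<integral>x. g (wrap x) \<partial>cube_measure)"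
    using arg_cong[OF D, of "\<lambda>M. integral\<^sup>L M g"] by (simp add: integral_distr)
  then show "(\<integral>x. g (t + c *\<^sub>R x) \<partial>cube_measure) = (\<integral>x. g x \<partial>cube_measure)" by (simp add: g)
  have "integrable cube_measure (\<lambda>x. g (wrap (t + c *\<^sub>R x))) \<longleftrightarrow>
      integrable cube_measure (\<lambda>x. g (wrap x))"
    using arg_cong[OF D, of "\<lambda>M. integrable M g"] by (simp add: integrable_distr_eq)
  then show "integrable cube_measure (\<lambda>x. g (t + c *\<^sub>R x)) \<longleftrightarrow> integrable cube_measure g"
    by (simp add: g)
qed

subsection \<open>Fourier coefficients and convolution\<close>

lemma borel_measurable_cnj [measurable]: "cnj \<in> borel_measurable borel"
  by (intro borel_measurable_continuous_onI continuous_intros)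

lemma measure_cube_measure_UNIV [simp]: "measure cube_measure UNIV = 1"
  using cube.prob_space by simp

lemma fourier_basis_measurable [measurable]: "fourier_basis k \<in> borel_measurable borel"
  unfolding fourier_basis_def by (intro borel_measurable_continuous_onI continuous_intros)

lemma norm_fourier_basis [simp]: "norm (fourier_basis k x) = 1"
  by (simp add: fourier_basis_def norm_exp_eq_Re)

lemma fourier_basis_add: "fourier_basis k (x + y) = fourier_basis k x * fourier_basis k y"
  by (simp add: fourier_basis_def exp_add[symmetric] sum.distrib distrib_left del: of_real_sum)

lemma fourier_basis_minus: "fourier_basis k (- x) = cnj (fourier_basis k x)"
  by (simp add: fourier_basis_def exp_cnj sum_negf del: of_real_sum)

lemma fourier_basis_diff: "fourier_basis k (x - y) = fourier_basis k x * cnj (fourier_basis k y)"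
  using fourier_basis_add[of k x "- y"] by (simp add: fourier_basis_minus)

lemma fourier_basis_index_diff:
  "fourier_basis (k - l) x = fourier_basis k x * cnj (fourier_basis l x)"
  by (simp add: fourier_basis_def exp_cnj exp_add[symmetric] left_diff_distrib right_diff_distrib
      sum_subtractf del: of_real_sum)

lemma cnj_fourier_basis_mult [simp]: "cnj (fourier_basis k x) * fourier_basis k x = 1"
  using complex_norm_square[of "fourier_basis k x"] by (simp add: mult.commute)

lemma fourier_basis_zero [simp]: "fourier_basis k 0 = 1" "fourier_basis 0 x = 1"
  by (simp_all add: fourier_basis_def)

lemma fourier_basis_int_vec [simp]: "fourier_basis k (int_vec m) = 1"
proof -
  have "fourier_basis k (int_vec m) =
      exp (\<i> * (complex_of_int (\<Sum>i\<in>UNIV. k $ i * m $ i) * (complex_of_real pi * 2)))"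
    by (simp add: fourier_basis_def int_vec_def mult_ac)
  also have "\<dots> = 1"
    by (rule exp_2pi_1_int)
  finally show ?thesis .
qed

lemma wrap_decomp: "x = wrap x + int_vec (\<chi> i. \<lfloor>x $ i\<rfloor>)"
  by (simp add: wrap_def int_vec_def vec_eq_iff frac_def)

lemma fourier_basis_wrap [simp]: "fourier_basis k (wrap x) = fourier_basis k x"
  using arg_cong[OF wrap_decomp[of x], of "fourier_basis k"]
    by (simp only: fourier_basis_add fourier_basis_int_vec mult_1_right)

section \<open>Periodic extensions and integrals over the cube\<close>

lemma periodic_ext_conv_wrap: "periodic_ext u x = indicator unit_cube (wrap x) *\<^sub>R u (wrap x)"
  by (simp add: periodic_ext_def wrap_def)

lemma periodic_ext_wrap [simp]: "periodic_ext u (wrap x) = periodic_ext u x"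
  by (simp add: periodic_ext_conv_wrap)

lemma periodic_ext_unit_cube: "x \<in> unit_cube \<Longrightarrow> periodic_ext u x = u x"
  by (simp add: periodic_ext_conv_wrap wrap_unit_cube)

lemma
  fixes h :: "real ^ 'd::finite \<Rightarrow> 'b::{banach, second_countable_topology}"
  assumes [measurable]: "h \<in> borel_measurable borel"
  shows set_integral_unit_cube: "(LINT x:unit_cube|lborel. h x) = (\<integral>x. h x \<partial>cube_measure)"
    and set_integrable_unit_cube: "set_integrable lborel unit_cube h \<longleftrightarrow> integrable cube_measure h"
proof -
  have D: "cube_measure = density lborel (\<lambda>x. ennreal (indicator unit_cube x))"
    by (simp add: cube_measure_def ennreal_indicator)
  show "(LINT x:unit_cube|lborel. h x) = (\<integral>x. h x \<partial>cube_measure)"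
    unfolding D set_lebesgue_integral_def by (subst integral_density) auto
  show "set_integrable lborel unit_cube h \<longleftrightarrow> integrable cube_measure h"
    unfolding D set_integrable_def by (subst integrable_density) auto
qed

lemma set_borel_measurable_unit_cube_iff:
  "set_borel_measurable lborel unit_cube u \<longleftrightarrow> periodic_ext u \<in> borel_measurable borel"
proof
  assume [measurable]: "set_borel_measurable lborel unit_cube u"
  have [measurable]: "(\<lambda>x. indicator unit_cube x *\<^sub>R u x) \<in> borel_measurable borel"
    using \<open>set_borel_measurable lborel unit_cube u\<close> by (simp add: set_borel_measurable_def)
  have "(\<lambda>x. (\<lambda>x. indicator unit_cube x *\<^sub>R u x) (wrap x)) \<in> borel_measurable borel"
    by (rule measurable_compose[OF measurable_wrap]) measurable
  then show "periodic_ext u \<in> borel_measurable borel"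
    by (simp add: periodic_ext_conv_wrap[abs_def])
next
  assume [measurable]: "periodic_ext u \<in> borel_measurable borel"
  have "(\<lambda>x. indicator unit_cube x *\<^sub>R u x) = (\<lambda>x. indicator unit_cube x *\<^sub>R periodic_ext u x)"
    by (auto simp: fun_eq_iff periodic_ext_unit_cube indicator_def)
  then show "set_borel_measurable lborel unit_cube u"
    by (simp add: set_borel_measurable_def)
qed

text \<open>An element of \<open>L2D\<close> need not be measurable outside the cube, so its
  integral against \<open>cube_measure\<close> could be the default value 0. Its periodic extension
  agrees with it on the cube and is Borel measurable, and takes its place from here on.\<close>

lemma set_integral_cong_periodic_ext:
  fixes F :: "real ^ 'd::finite \<Rightarrow> complex \<Rightarrow> 'b::{banach, second_countable_topology}"
  assumes "(\<lambda>x. F x (periodic_ext u x)) \<in> borel_measurable borel"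
  shows "(LINT x:unit_cube|lborel. F x (u x)) = (\<integral>x. F x (periodic_ext u x) \<partial>cube_measure)"
proof -
  have "(LINT x:unit_cube|lborel. F x (u x)) = (LINT x:unit_cube|lborel. F x (periodic_ext u x))"
    unfolding set_lebesgue_integral_def
    by (intro Bochner_Integration.integral_cong) (auto simp: periodic_ext_unit_cube indicator_def)
  then show ?thesis using assms by (simp add: set_integral_unit_cube)
qed

lemma L2D_iff:
  "u \<in> L2D \<longleftrightarrow> periodic_ext u \<in> borel_measurable borel \<and>
     integrable cube_measure (\<lambda>x. (norm (periodic_ext u x))\<^sup>2)"
proof -
  have "set_integrable lborel unit_cube (\<lambda>x. (norm (u x))\<^sup>2) \<longleftrightarrow>
        set_integrable lborel unit_cube (\<lambda>x. (norm (periodic_ext u x))\<^sup>2)"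
    unfolding set_integrable_def
    by (intro Bochner_Integration.integrable_cong) (auto simp: periodic_ext_unit_cube indicator_def)
  moreover have "set_integrable lborel unit_cube (\<lambda>x. (norm (periodic_ext u x))\<^sup>2) \<longleftrightarrow>
      integrable cube_measure (\<lambda>x. (norm (periodic_ext u x))\<^sup>2)"
    if [measurable]: "periodic_ext u \<in> borel_measurable borel"
    by (rule set_integrable_unit_cube) measurable
  ultimately show ?thesis
    unfolding L2D_def mem_Collect_eq set_borel_measurable_unit_cube_iff by blast
qed

lemma L2D_periodic_ext_measurable: "u \<in> L2D \<Longrightarrow> periodic_ext u \<in> borel_measurable borel"
  by (simp add: L2D_iff)

lemma L2D_I:
  assumes [measurable]: "u \<in> borel_measurable borel"
      and "integrable cube_measure (\<lambda>x. (norm (u x))\<^sup>2)"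
  shows "u \<in> L2D"
  using assms by (simp add: L2D_def set_borel_measurable_def set_integrable_unit_cube)

lemma L2D_bounded:
  assumes [measurable]: "u \<in> borel_measurable borel" and "\<And>x. norm (u x) \<le> B"
  shows "u \<in> L2D"
proof (rule L2D_I)
  show "integrable cube_measure (\<lambda>x. (norm (u x))\<^sup>2)"
    using assms(2) by (intro cube.integrable_const_bound[where B = "B\<^sup>2"])
        (auto intro!: AE_I2 power_mono)
qed fact

lemma L2_norm_eq: "u \<in> L2D \<Longrightarrow> L2_norm u = sqrt (\<integral>x. (norm (periodic_ext u x))\<^sup>2 \<partial>cube_measure)"
  unfolding L2_norm_def
  by (subst set_integral_cong_periodic_ext[of "\<lambda>x z. (norm z)\<^sup>2"])
     (auto dest: L2D_periodic_ext_measurable)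

lemma L2_norm_nonneg [simp]: "0 \<le> L2_norm u"
  by (simp add: L2_norm_def set_lebesgue_integral_def)

lemma fourier_coeff_eq:
  assumes u: "u \<in> L2D"
  shows "fourier_coeff u k = (\<integral>x. cnj (fourier_basis k x) * periodic_ext u x \<partial>cube_measure)"
proof -
  note [measurable] = L2D_periodic_ext_measurable[OF u]
  show ?thesis
    unfolding fourier_coeff_def
    by (rule set_integral_cong_periodic_ext[of "\<lambda>x z. cnj (fourier_basis k x) * z"]) measurable
qed

lemma convolution_eq:
  assumes u: "u \<in> L2D" and v: "v \<in> L2D"
  shows "convolution u v x = (\<integral>y. periodic_ext u (x - y) * periodic_ext v y \<partial>cube_measure)"
proof -
  note [measurable] = L2D_periodic_ext_measurable[OF u] L2D_periodic_ext_measurable[OF v]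
  show ?thesis
    unfolding convolution_def
    by (rule set_integral_cong_periodic_ext[of "\<lambda>y z. periodic_ext u (x - y) * z"]) measurable
qed

section \<open>Cauchy-Schwarz and the convolution theorem\<close>

lemma
  fixes f g :: "'a \<Rightarrow> real"
  assumes [measurable]: "f \<in> borel_measurable M" "g \<in> borel_measurable M"
    and f: "integrable M (\<lambda>x. (f x)\<^sup>2)" and g: "integrable M (\<lambda>x. (g x)\<^sup>2)"
  shows integrable_mult_square_integrable: "integrable M (\<lambda>x. f x * g x)"
    and integral_abs_mult_le_sqrt:
      "(\<integral>x. \<bar>f x * g x\<bar> \<partial>M) \<le> sqrt (\<integral>x. (f x)\<^sup>2 \<partial>M) * sqrt (\<integral>x. (g x)\<^sup>2 \<partial>M)"
proof -
  show int: "integrable M (\<lambda>x. f x * g x)"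
  proof (rule Bochner_Integration.integrable_bound)
    show "integrable M (\<lambda>x. (f x)\<^sup>2 + (g x)\<^sup>2)" using f g by simp
    show "AE x in M. norm (f x * g x) \<le> norm ((f x)\<^sup>2 + (g x)\<^sup>2)"
    proof (rule AE_I2)
      fix x
      have "2 * (\<bar>f x\<bar> * \<bar>g x\<bar>) \<le> (f x)\<^sup>2 + (g x)\<^sup>2"
        using sum_squares_bound[of "\<bar>f x\<bar>" "\<bar>g x\<bar>"] by (simp add: mult.assoc)
      moreover have "0 \<le> \<bar>f x\<bar> * \<bar>g x\<bar>" by simp
      ultimately have "\<bar>f x\<bar> * \<bar>g x\<bar> \<le> (f x)\<^sup>2 + (g x)\<^sup>2" by linarith
      then show "norm (f x * g x) \<le> norm ((f x)\<^sup>2 + (g x)\<^sup>2)" by (simp add: abs_mult)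
    qed
  qed measurable
  have "ennreal ((\<integral>x. \<bar>f x * g x\<bar> \<partial>M)\<^sup>2) = (\<integral>\<^sup>+x. ennreal \<bar>f x\<bar> * ennreal \<bar>g x\<bar> \<partial>M)\<^sup>2"
  proof -
    have "ennreal (\<integral>x. \<bar>f x * g x\<bar> \<partial>M) = (\<integral>\<^sup>+x. ennreal \<bar>f x * g x\<bar> \<partial>M)"
      using int by (intro nn_integral_eq_integral[symmetric] integrable_abs) auto
    then show ?thesis
      by (simp add: abs_mult ennreal_mult flip: ennreal_power)
  qed
  also have "\<dots> \<le> (\<integral>\<^sup>+x. ennreal \<bar>f x\<bar> ^ 2 \<partial>M) * (\<integral>\<^sup>+x. ennreal \<bar>g x\<bar> ^ 2 \<partial>M)"
    by (rule Cauchy_Schwarz_nn_integral) auto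
  also have "\<dots> = ennreal ((\<integral>x. (f x)\<^sup>2 \<partial>M) * (\<integral>x. (g x)\<^sup>2 \<partial>M))"
    using f g by (simp add: ennreal_power nn_integral_eq_integral ennreal_mult)
  finally have "(\<integral>x. \<bar>f x * g x\<bar> \<partial>M)\<^sup>2 \<le> (\<integral>x. (f x)\<^sup>2 \<partial>M) * (\<integral>x. (g x)\<^sup>2 \<partial>M)"
    by (simp add: ennreal_le_iff)
  then show "(\<integral>x. \<bar>f x * g x\<bar> \<partial>M) \<le> sqrt (\<integral>x. (f x)\<^sup>2 \<partial>M) * sqrt (\<integral>x. (g x)\<^sup>2 \<partial>M)"
    by (simp add: real_le_rsqrt flip: real_sqrt_mult)
qed

lemma L2D_integrable:
  assumes u: "u \<in> L2D"
  shows "integrable cube_measure (periodic_ext u)"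
proof -
  note [measurable] = L2D_periodic_ext_measurable[OF u]
  have "integrable cube_measure (\<lambda>x. norm (periodic_ext u x) * 1)"
    using u by (intro integrable_mult_square_integrable) (auto simp: L2D_iff)
  then show ?thesis by (simp add: integrable_norm_iff)
qed

text \<open>For fixed \<open>x\<close> the map \<open>\<lambda>y. x - y\<close> preserves cube
  integrals of periodic functions, so Cauchy-Schwarz applies with a bound independent of
  \<open>x\<close>. It holds at every point, not just almost everywhere, so convolutions are bounded
  functions.\<close>

lemma
  assumes u: "u \<in> L2D" and v: "v \<in> L2D"
  shows convolution_integrable: "integrable cube_measure (\<lambda>y. periodic_ext u (x - y) *
      periodic_ext v y)"
    and convolution_abs_bound:
      "(\<integral>y. norm (periodic_ext u (x - y) * periodic_ext v y) \<partial>cube_measure) \<le> L2_norm u * L2_norm v"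
    and norm_convolution_le: "norm (convolution u v x) \<le> L2_norm u * L2_norm v"
proof -
  note [measurable] = L2D_periodic_ext_measurable[OF u] L2D_periodic_ext_measurable[OF v]
  have iu: "integrable cube_measure (\<lambda>y. (norm (periodic_ext u (x - y)))\<^sup>2)"
    using integrable_cube_affine_sign[of "\<lambda>y. (norm (periodic_ext u y))\<^sup>2" "-1" x] u
      by (simp add: L2D_iff)
  have eu: "(\<integral>y. (norm (periodic_ext u (x - y)))\<^sup>2 \<partial>cube_measure) =
      (\<integral>y. (norm (periodic_ext u y))\<^sup>2 \<partial>cube_measure)"
    using integral_cube_affine_sign[of "\<lambda>y. (norm (periodic_ext u y))\<^sup>2" "-1" x] by simp
  have iv: "integrable cube_measure (\<lambda>y. (norm (periodic_ext v y))\<^sup>2)" using v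
    by (simp add: L2D_iff)
  have "integrable cube_measure (\<lambda>y. norm (periodic_ext u (x - y)) * norm (periodic_ext v y))"
    by (rule integrable_mult_square_integrable[OF _ _ iu iv]) auto
  then have "integrable cube_measure (\<lambda>y. norm (periodic_ext u (x - y) * periodic_ext v y))"
    by (simp add: norm_mult)
  then show "integrable cube_measure (\<lambda>y. periodic_ext u (x - y) * periodic_ext v y)"
    by (subst (asm) integrable_norm_iff) auto
  show le: "(\<integral>y. norm (periodic_ext u (x - y) * periodic_ext v y) \<partial>cube_measure) \<le>
      L2_norm u * L2_norm v"
    using integral_abs_mult_le_sqrt[OF _ _ iu iv] u v by (simp add: eu L2_norm_eq norm_mult)
  have "norm (convolution u v x) \<le> (\<integral>y. norm (periodic_ext u (x - y) *
      periodic_ext v y) \<partial>cube_measure)"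
    unfolding convolution_eq[OF u v] by (rule integral_norm_bound)
  with le show "norm (convolution u v x) \<le> L2_norm u * L2_norm v" by linarith
qed

lemma convolution_L2D:
  assumes u: "u \<in> L2D" and v: "v \<in> L2D"
  shows "convolution u v \<in> L2D"
proof (rule L2D_bounded[OF _ norm_convolution_le[OF u v]])
  note [measurable] = L2D_periodic_ext_measurable[OF u] L2D_periodic_ext_measurable[OF v]
  have "(\<lambda>x. \<integral>y. periodic_ext u (x - y) * periodic_ext v y \<partial>cube_measure) \<in> borel_measurable borel"
    by (rule cube.borel_measurable_lebesgue_integral) measurable
  then show "convolution u v \<in> borel_measurable borel"
    by (simp add: convolution_eq[OF u v, abs_def])
qed

text \<open>After Fubini, the character at \<open>x\<close> splits into its values at
  \<open>x - y\<close> and at \<open>y\<close>, and translation invariance turns the inner integral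
  into a coefficient of \<open>u\<close>.\<close>

lemma fourier_coeff_convolution:
  assumes u: "u \<in> L2D" and v: "v \<in> L2D"
  shows "fourier_coeff (convolution u v) k = fourier_coeff u k * fourier_coeff v k"
proof -
  note [measurable] = L2D_periodic_ext_measurable[OF u] L2D_periodic_ext_measurable[OF v]
  let ?f = "\<lambda>x y. cnj (fourier_basis k x) * (periodic_ext u (x - y) * periodic_ext v y)"
  \<comment> \<open>Characters have modulus 1, so the inner integral of norms is at most
    \<open>L2_norm u * L2_norm v\<close> for every \<open>x\<close>; on a probability space this
    gives joint integrability.\<close>
  have int: "integrable (cube_measure \<Otimes>\<^sub>M cube_measure) (\<lambda>(x, y). ?f x y)"
  proof (rule cube2.Fubini_integrable)
    show "integrable cube_measure (\<lambda>x. \<integral>y. norm (case (x, y) of (x, y) \<Rightarrow> ?f x y) \<partial>cube_measure)"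
    proof (rule cube.integrable_const_bound)
      show "AE x in cube_measure. norm (\<integral>y. norm (case (x, y) of (x, y) \<Rightarrow> ?f x y) \<partial>cube_measure) \<le>
          L2_norm u * L2_norm v"
        using convolution_abs_bound[OF u v] by (simp add: norm_mult)
    qed measurable
    show "AE x in cube_measure. integrable cube_measure (\<lambda>y. case (x, y) of (x, y) \<Rightarrow> ?f x y)"
      using convolution_integrable[OF u v] by simp
  qed measurable
  have inner: "(\<integral>x. ?f x y \<partial>cube_measure) = fourier_coeff u k * (cnj (fourier_basis k y) *
      periodic_ext v y)" for y
  proof -
    let ?h = "\<lambda>x. cnj (fourier_basis k x) * periodic_ext u x"
    have "?f x y = ?h (- y + 1 *\<^sub>R x) * (cnj (fourier_basis k y) * periodic_ext v y)" for x
      using fourier_basis_add[of k "x - y" y] by simp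
    then have "(\<integral>x. ?f x y \<partial>cube_measure) = (\<integral>x. ?h (- y + 1 *\<^sub>R x) * (cnj (fourier_basis k y) *
        periodic_ext v y) \<partial>cube_measure)"
      by (simp only:)
    also have "\<dots> = (\<integral>x. ?h (- y + 1 *\<^sub>R x) \<partial>cube_measure) * (cnj (fourier_basis k y) *
        periodic_ext v y)"
      by (rule integral_mult_left_zero)
    also have "(\<integral>x. ?h (- y + 1 *\<^sub>R x) \<partial>cube_measure) = fourier_coeff u k"
      unfolding fourier_coeff_eq[OF u] by (rule integral_cube_affine_sign) auto
    finally show ?thesis .
  qed
  have "fourier_coeff (convolution u v) k = (LINT x:unit_cube|lborel. cnj (fourier_basis k x) *
      (\<integral>y. periodic_ext u (x - y) * periodic_ext v y \<partial>cube_measure))"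
    by (simp add: fourier_coeff_def convolution_eq[OF u v])
  also have "\<dots> = (\<integral>x. cnj (fourier_basis k x) * (\<integral>y. periodic_ext u (x - y) *
      periodic_ext v y \<partial>cube_measure) \<partial>cube_measure)"
    by (rule set_integral_unit_cube) measurable
  also have "\<dots> = (\<integral>x. (\<integral>y. ?f x y \<partial>cube_measure) \<partial>cube_measure)" by simp
  also have "\<dots> = (\<integral>y. (\<integral>x. ?f x y \<partial>cube_measure) \<partial>cube_measure)"
    by (rule cube2.Fubini_integral[OF int, symmetric])
  also have "\<dots> = fourier_coeff u k * fourier_coeff v k"
    by (simp add: inner fourier_coeff_eq[OF v])
  finally show ?thesis .
qed

section \<open>Trigonometric polynomials, Fourier series and Bessel's inequality\<close>

lemma fourier_basis_L2D: "fourier_basis k \<in> L2D"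
  by (rule L2D_bounded[where B = 1]) auto

lemma trig_poly_L2D: "(\<lambda>x. \<Sum>k\<in>F. c k * fourier_basis k x) \<in> L2D"
proof (rule L2D_bounded)
  show "norm (\<Sum>k\<in>F. c k * fourier_basis k x) \<le> (\<Sum>k\<in>F. norm (c k))" for x
    by (rule order_trans[OF norm_sum]) (simp add: norm_mult)
qed measurable

lemma L2D_diff:
  assumes u: "u \<in> L2D" and v: "v \<in> L2D"
  shows "(\<lambda>x. u x - v x) \<in> L2D"
proof -
  note [measurable] = L2D_periodic_ext_measurable[OF u] L2D_periodic_ext_measurable[OF v]
  have eq: "periodic_ext (\<lambda>x. u x - v x) = (\<lambda>x. periodic_ext u x - periodic_ext v x)"
    by (simp add: fun_eq_iff periodic_ext_def)
  have "integrable cube_measure (\<lambda>x. (norm (periodic_ext u x - periodic_ext v x))\<^sup>2)"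
  proof (rule Bochner_Integration.integrable_bound)
    show "integrable cube_measure (\<lambda>x. 2 * (norm (periodic_ext u x))\<^sup>2 + 2 *
        (norm (periodic_ext v x))\<^sup>2)"
      using u v by (simp add: L2D_iff)
    have "(norm (a - b))\<^sup>2 \<le> 2 * (norm a)\<^sup>2 + 2 * (norm b)\<^sup>2" for a b :: complex
    proof -
      have "(norm (a - b))\<^sup>2 \<le> (norm a + norm b)\<^sup>2" by (intro power_mono norm_triangle_ineq4) simp
      also have "\<dots> \<le> 2 * (norm a)\<^sup>2 + 2 * (norm b)\<^sup>2"
        using sum_squares_bound[of "norm a" "norm b"] by (simp add: power2_sum)
      finally show ?thesis .
    qed
    then show "AE x in cube_measure. norm ((norm (periodic_ext u x - periodic_ext v x))\<^sup>2)
        \<le> norm (2 * (norm (periodic_ext u x))\<^sup>2 + 2 * (norm (periodic_ext v x))\<^sup>2)"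
      by (intro AE_I2) simp
  qed measurable
  then show ?thesis by (simp add: L2D_iff eq)
qed

text \<open>The substitution \<open>z = x - y\<close> and the splitting of
  \<open>fourier_basis k (x - z)\<close> show that characters are eigenfunctions of convolution with
  \<open>u\<close>.\<close>

lemma convolution_fourier_basis:
  assumes u: "u \<in> L2D"
  shows "convolution u (fourier_basis k) x = fourier_coeff u k * fourier_basis k x"
proof -
  note [measurable] = L2D_periodic_ext_measurable[OF u]
  let ?g = "\<lambda>z. periodic_ext u z * fourier_basis k (x - z)"
  have "fourier_basis k (x - wrap z) = fourier_basis k (x - z)" for z
    by (simp add: fourier_basis_diff)
  then have "(\<integral>y. ?g (x + (-1) *\<^sub>R y) \<partial>cube_measure) = (\<integral>z. ?g z \<partial>cube_measure)"
    by (intro integral_cube_affine_sign) auto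
  moreover have "convolution u (fourier_basis k) x = (\<integral>y. ?g (x + (-1) *\<^sub>R y) \<partial>cube_measure)"
    unfolding convolution_def by (subst set_integral_unit_cube) auto
  moreover have "(\<integral>z. ?g z \<partial>cube_measure) = (\<integral>z. fourier_basis k x * (cnj (fourier_basis k z) *
      periodic_ext u z) \<partial>cube_measure)"
    by (simp add: fourier_basis_diff mult_ac)
  moreover have "\<dots> = fourier_coeff u k * fourier_basis k x"
    by (simp add: fourier_coeff_eq[OF u])
  ultimately show ?thesis by simp
qed

text \<open>For \<open>k \<noteq> 0\<close> a suitable translation changes the sign of the character
  but not its integral.\<close>

lemma integral_fourier_basis:
  "(\<integral>x. fourier_basis k x \<partial>cube_measure) = (if k = 0 then 1 else 0)"
proof (cases "k = 0")
  case True
  then show ?thesis by simp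
next
  case False
  then obtain i where i: "k $ i \<noteq> 0" by (auto simp: vec_eq_iff)
  \<comment> \<open>Half a period of the character in direction \<open>i\<close>, so that its value
    at \<open>y\<close> is -1.\<close>
  define y :: "real ^ 'a" where "y = (1 / (2 * real_of_int (k $ i))) *\<^sub>R axis i 1"
  have sum: "(\<Sum>j\<in>UNIV. real_of_int (k $ j) * y $ j) = 1 / 2"
    using i by (subst sum.remove[of _ i]) (auto simp: y_def axis_def intro!: sum.neutral)
  have y: "fourier_basis k y = -1"
    unfolding fourier_basis_def sum by (simp add: mult.commute[of pi])
  have "(\<integral>x. fourier_basis k (y + 1 *\<^sub>R x) \<partial>cube_measure) = (\<integral>x. fourier_basis k x \<partial>cube_measure)"
    by (rule integral_cube_affine_sign) auto
  then have "- (\<integral>x. fourier_basis k x \<partial>cube_measure) = (\<integral>x. fourier_basis k x \<partial>cube_measure)"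
    by (simp add: fourier_basis_add y)
  then show ?thesis using False by simp
qed

lemma fourier_coeff_fourier_basis: "fourier_coeff (fourier_basis l) k = (if k = l then 1 else 0)"
proof -
  have "fourier_coeff (fourier_basis l) k = (\<integral>x. fourier_basis (l - k) x \<partial>cube_measure)"
    unfolding fourier_coeff_def
    by (subst set_integral_unit_cube) (auto simp: fourier_basis_index_diff[abs_def] mult_ac)
  then show ?thesis by (simp add: integral_fourier_basis)
qed

lemma L2_norm_trig_poly:
  assumes "finite F"
  shows "(L2_norm (\<lambda>x. \<Sum>k\<in>F. c k * fourier_basis k x))\<^sup>2 = (\<Sum>k\<in>F. (norm (c k))\<^sup>2)"
proof -
  let ?S = "\<lambda>x. \<Sum>k\<in>F. c k * fourier_basis k x"
  have [simp]: "integrable cube_measure (fourier_basis m)" for m :: "int ^ 'a"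
    by (rule cube.integrable_const_bound[where B = 1]) auto
  have "(L2_norm ?S)\<^sup>2 = (\<integral>x. (norm (?S x))\<^sup>2 \<partial>cube_measure)"
    unfolding L2_norm_def by (simp add: set_integral_unit_cube)
  then have "complex_of_real ((L2_norm ?S)\<^sup>2) = (\<integral>x. ?S x * cnj (?S x) \<partial>cube_measure)"
    by (simp add: complex_norm_square del: of_real_power flip: integral_complex_of_real)
  also have "\<dots> = (\<integral>x. (\<Sum>k\<in>F. \<Sum>l\<in>F. c k * cnj (c l) * fourier_basis (k - l) x) \<partial>cube_measure)"
    by (simp add: sum_product fourier_basis_index_diff mult_ac)
  also have "\<dots> = (\<Sum>k\<in>F. \<Sum>l\<in>F. c k * cnj (c l) * (if k - l = 0 then 1 else 0))"
    by (simp add: integral_fourier_basis)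
  also have "\<dots> = (\<Sum>k\<in>F. c k * cnj (c k))"
    using assms by (intro sum.cong refl) (simp add: if_distrib cong: if_cong)
  also have "\<dots> = complex_of_real (\<Sum>k\<in>F. (norm (c k))\<^sup>2)"
    by (simp add: complex_norm_square del: of_real_power)
  finally show ?thesis by (simp only: of_real_eq_iff)
qed

lemma convolution_diff:
  assumes u: "u \<in> L2D" and v: "v \<in> L2D" and w: "w \<in> L2D"
  shows "convolution u (\<lambda>x. v x - w x) x = convolution u v x - convolution u w x"
proof -
  have eq: "periodic_ext (\<lambda>x. v x - w x) = (\<lambda>x. periodic_ext v x - periodic_ext w x)"
    by (simp add: fun_eq_iff periodic_ext_def)
  show ?thesis
    using convolution_integrable[OF u v] convolution_integrable[OF u w]
    by (simp add: convolution_eq u v w L2D_diff eq right_diff_distrib)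
qed

lemma convolution_trig_poly:
  assumes u: "u \<in> L2D"
  shows "convolution u (\<lambda>x. \<Sum>k\<in>F. c k * fourier_basis k x) x =
      (\<Sum>k\<in>F. c k * fourier_coeff u k * fourier_basis k x)"
proof -
  note [measurable] = L2D_periodic_ext_measurable[OF u]
  have int: "integrable cube_measure (\<lambda>y. periodic_ext u (x - y) * fourier_basis k y)" for k
  proof -
    have "integrable cube_measure (\<lambda>y. periodic_ext u (x - y))"
      using integrable_cube_affine_sign[of "periodic_ext u" "-1" x] L2D_integrable[OF u] by simp
    then show ?thesis
      by (rule Bochner_Integration.integrable_bound) (auto simp: norm_mult)
  qed
  have "convolution u (\<lambda>x. \<Sum>k\<in>F. c k * fourier_basis k x) x =
      (\<integral>y. (\<Sum>k\<in>F. c k * (periodic_ext u (x - y) * fourier_basis k y)) \<partial>cube_measure)"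
    unfolding convolution_def by (subst set_integral_unit_cube)
        (auto simp: sum_distrib_left mult_ac)
  also have "\<dots> = (\<Sum>k\<in>F. c k * (\<integral>y. periodic_ext u (x - y) * fourier_basis k y \<partial>cube_measure))"
    using int by simp
  also have "\<dots> = (\<Sum>k\<in>F. c k * convolution u (fourier_basis k) x)"
    unfolding convolution_def by (simp add: set_integral_unit_cube)
  finally show ?thesis by (simp add: convolution_fourier_basis[OF u] mult.assoc)
qed

text \<open>Convolution with \<open>u\<close> is continuous from the L2 norm to the supremum norm,
  so L2 convergence of the series of \<open>v\<close> becomes convergence at every \<open>x\<close>.
  Both the coefficients of \<open>v\<close> and the pointwise Fourier series of the chain come from
  this.\<close>

lemma convolution_L2_has_sum:
  assumes u: "u \<in> L2D" and sum: "L2_has_sum (\<lambda>k x. c k * fourier_basis k x) v"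
  shows "((\<lambda>k. c k * fourier_coeff u k * fourier_basis k x) has_sum convolution u v x) UNIV"
proof -
  have v: "v \<in> L2D"
    and lim: "((\<lambda>F. L2_norm (\<lambda>x. v x - (\<Sum>k\<in>F. c k * fourier_basis k x)))
        \<longlongrightarrow> 0) (finite_subsets_at_top UNIV)"
    using sum by (auto simp: L2_has_sum_def)
  have bound: "norm ((\<Sum>k\<in>F. c k * fourier_coeff u k * fourier_basis k x) - convolution u v x)
      \<le> L2_norm u * L2_norm (\<lambda>x. v x - (\<Sum>k\<in>F. c k * fourier_basis k x))" for F
    using norm_convolution_le[OF u L2D_diff[OF v trig_poly_L2D], where x = x]
    by (simp add: convolution_diff[OF u v trig_poly_L2D] convolution_trig_poly[OF u]
        norm_minus_commute)
  have "((\<lambda>F. L2_norm u * L2_norm (\<lambda>x. v x - (\<Sum>k\<in>F. c k * fourier_basis k x))) \<longlongrightarrow> L2_norm u * 0)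
      (finite_subsets_at_top UNIV)"
    by (intro tendsto_intros lim)
  then have "((\<lambda>F. (\<Sum>k\<in>F. c k * fourier_coeff u k * fourier_basis k x) - convolution u v x) \<longlongrightarrow> 0)
      (finite_subsets_at_top UNIV)"
    by (intro Lim_null_comparison[OF always_eventually[OF allI, OF bound]]) simp
  then show ?thesis by (simp add: has_sum_def LIM_zero_iff)
qed

text \<open>Convolving with \<open>fourier_basis k\<close> kills every term of the series but the
  \<open>k\<close>-th; the \<open>k\<close>-th coefficient of the result is then computed in two
  ways.\<close>

lemma fourier_coeff_L2_has_sum:
  assumes sum: "L2_has_sum (\<lambda>k x. c k * fourier_basis k x) v"
  shows "fourier_coeff v k = c k"
proof -
  have v: "v \<in> L2D" using sum by (simp add: L2_has_sum_def)
  have "convolution (fourier_basis k) v x = c k * fourier_basis k x" for x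
  proof (rule has_sum_unique)
    show "((\<lambda>l. c l * fourier_coeff (fourier_basis k) l * fourier_basis l x) has_sum
        convolution (fourier_basis k) v x) UNIV"
      by (rule convolution_L2_has_sum[OF fourier_basis_L2D sum])
    show "((\<lambda>l. c l * fourier_coeff (fourier_basis k) l * fourier_basis l x)
        has_sum c k * fourier_basis k x) UNIV"
      by (rule has_sum_finite_neutralI[of "{k}"]) (auto simp: fourier_coeff_fourier_basis)
  qed
  then have "convolution (fourier_basis k) v = (\<lambda>x. c k * fourier_basis k x)" by blast
  moreover have "fourier_coeff (\<lambda>x. c k * fourier_basis k x) k = c k"
    unfolding fourier_coeff_def by (subst set_integral_unit_cube)
        (auto simp: mult.left_commute[of _ "c k"])
  ultimately show ?thesis
    using fourier_coeff_convolution[OF fourier_basis_L2D v, of k k]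
      by (simp add: fourier_coeff_fourier_basis)
qed

text \<open>Duality: \<open>S\<close> has the conjugate coefficients, so the convolution of
  \<open>v\<close> with \<open>S\<close> at 0 equals the partial sum \<open>A\<close>, while
  \<open>S\<close> has norm \<open>sqrt A\<close>. Hence
  \<open>A \<le> L2_norm v * sqrt A\<close>.\<close>

lemma bessel_inequality:
  assumes v: "v \<in> L2D" and F: "finite F"
  shows "(\<Sum>k\<in>F. (norm (fourier_coeff v k))\<^sup>2) \<le> (L2_norm v)\<^sup>2"
proof -
  define c where "c k = cnj (fourier_coeff v k)" for k
  define S where "S = (\<lambda>x. \<Sum>k\<in>F. c k * fourier_basis k x)"
  define A where "A = (\<Sum>k\<in>F. (norm (fourier_coeff v k))\<^sup>2)"
  have A0: "0 \<le> A" by (simp add: A_def sum_nonneg)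
  have S: "S \<in> L2D" unfolding S_def by (rule trig_poly_L2D)
  have "(L2_norm S)\<^sup>2 = A" unfolding S_def L2_norm_trig_poly[OF F] by (simp add: c_def A_def)
  then have nS: "L2_norm S = sqrt A" by (metis L2_norm_nonneg real_sqrt_unique)
  have "convolution v S 0 = complex_of_real A"
    unfolding S_def convolution_trig_poly[OF v]
    by (simp add: c_def A_def complex_norm_square mult.commute del: of_real_power)
  then have "A \<le> L2_norm v * sqrt A"
    using norm_convolution_le[OF v S, of 0] A0 by (simp add: nS)
  then have "sqrt A * sqrt A \<le> L2_norm v * sqrt A" using A0 by simp
  then have "sqrt A \<le> L2_norm v"
    using A0 mult_right_le_imp_le[of "sqrt A" "sqrt A" "L2_norm v"] by (cases "A = 0") auto
  then have "(sqrt A)\<^sup>2 \<le> (L2_norm v)\<^sup>2" using A0 by (intro power_mono) auto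
  then show ?thesis using A0 by (simp add: A_def)
qed

subsection \<open>Products of standard normal variables\<close>

text \<open>Substitute \<open>t = x\<^sup>2 / 2\<close> in Euler's integral for Gamma at
  \<open>a = (p + 1) / 2\<close>; the condition \<open>p > -1\<close> is
  \<open>a > 0\<close>.\<close>

lemma gaussian_abs_moment_half_line:
  fixes p :: real
  assumes p: "p > -1"
  shows "((\<lambda>x. x powr p * exp (- x\<^sup>2 / 2)) has_integral 2 powr ((p - 1) / 2) *
      Gamma ((p + 1) / 2)) {0<..}"
proof -
  define a where "a = (p + 1) / 2"
  have a: "a > 0" using p by (simp add: a_def)
  define h where "h t = t powr (a - 1) / exp t" for t :: real
  have "((\<lambda>t. if t \<in> {0..} then h t else 0) has_integral Gamma a) UNIV"
    using Gamma_integral_real[OF a] by (subst has_integral_restrict_UNIV) (simp add: h_def[abs_def])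
  also have "(\<lambda>t. if t \<in> {0..} then h t else 0) = (\<lambda>t. if t \<in> {0<..} then h t else 0)"
    by (auto simp: fun_eq_iff h_def)
  finally have h: "(h has_integral Gamma a) {0<..}"
    by (simp only: has_integral_restrict_UNIV)
  have img: "(\<lambda>x::real. x\<^sup>2 / 2) ` {0<..} = {0<..}"
  proof safe
    fix t :: real assume "t > 0"
    then show "t \<in> (\<lambda>x. x\<^sup>2 / 2) ` {0<..}"
      by (intro image_eqI[of _ _ "sqrt (2 * t)"]) auto
  qed simp
  have "h absolutely_integrable_on {0<..}"
    using h by (intro nonnegative_absolutely_integrable_1) (auto simp: h_def has_integral_iff)
  then have "h absolutely_integrable_on (\<lambda>x. x\<^sup>2 / 2) ` {0<..} \<and>
      integral ((\<lambda>x. x\<^sup>2 / 2) ` {0<..}) h = Gamma a"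
    using h by (simp only: img has_integral_iff)
  then have "(\<lambda>x. \<bar>x\<bar> * h (x\<^sup>2 / 2)) absolutely_integrable_on {0<..} \<and>
      integral {0<..} (\<lambda>x. \<bar>x\<bar> * h (x\<^sup>2 / 2)) = Gamma a"
    by (subst has_absolute_integral_change_of_variables_1'[where g = "\<lambda>x. x\<^sup>2 / 2"])
       (auto intro!: derivative_eq_intros inj_onI)
  then have "((\<lambda>x. \<bar>x\<bar> * h (x\<^sup>2 / 2)) has_integral Gamma a) {0<..}"
    by (auto simp: has_integral_iff intro: set_lebesgue_integral_eq_integral(1)
        absolutely_integrable_on_def[THEN iffD1])
  then have "((\<lambda>x. 2 powr (a - 1) * (\<bar>x\<bar> * h (x\<^sup>2 / 2)))
      has_integral 2 powr (a - 1) * Gamma a) {0<..}"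
    by (rule has_integral_mult_right)
  moreover have "2 powr (a - 1) * (\<bar>x\<bar> * h (x\<^sup>2 / 2)) = x powr p * exp (- x\<^sup>2 / 2)"
    if "x \<in> {0<..}" for x
  proof -
    have x: "x > 0" using that by simp
    have "(x\<^sup>2 / 2) powr (a - 1) = x powr (2 * (a - 1)) / 2 powr (a - 1)"
      using x by (simp add: powr_divide powr_powr flip: powr_numeral)
    moreover have "x * x powr (2 * (a - 1)) = x powr p"
      using x powr_add[of x 1 "2 * (a - 1)"] by (simp add: a_def field_simps)
    ultimately show ?thesis
      using x by (simp add: h_def exp_minus field_simps)
  qed
  ultimately have "((\<lambda>x. x powr p * exp (- x\<^sup>2 / 2)) has_integral 2 powr (a - 1) * Gamma a) {0<..}"
    by (rule has_integral_eq[rotated])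
  moreover have "a - 1 = (p - 1) / 2" by (simp add: a_def field_simps)
  ultimately show ?thesis by (simp add: a_def)
qed

text \<open>The integrand is even, so the half-line integral is doubled. Density times function is
  the form in which \<open>distributed_nn_integral\<close> delivers expectations.\<close>

lemma std_normal_abs_moment:
  fixes p :: real
  assumes p: "p > -1"
  shows "(\<integral>\<^sup>+x. ennreal (std_normal_density x) * ennreal (\<bar>x\<bar> powr p) \<partial>lborel) =
         ennreal (2 powr (p / 2) * Gamma ((p + 1) / 2) / sqrt pi)"
proof -
  define f :: "real \<Rightarrow> real" where "f x = \<bar>x\<bar> powr p * exp (- x\<^sup>2 / 2)" for x
  define G where "G = 2 powr ((p - 1) / 2) * Gamma ((p + 1) / 2)"
  have G0: "G \<ge> 0" using p by (simp add: G_def)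
  have [measurable]: "f \<in> borel_measurable borel" unfolding f_def by measurable
  have "(\<integral>\<^sup>+x. ennreal (indicator {0..} x *\<^sub>R f x) \<partial>lborel) =
      (\<integral>\<^sup>+x. ennreal (x powr p * exp (- x\<^sup>2 / 2)) * indicator {0<..} x \<partial>lborel)"
    by (intro nn_integral_cong) (auto simp: indicator_def f_def)
  also have "\<dots> = ennreal G"
    unfolding G_def using gaussian_abs_moment_half_line[OF p]
      by (intro nn_integral_has_integral_lebesgue') auto
  finally have "has_bochner_integral lborel (\<lambda>x. indicator {0..} x *\<^sub>R f x) G"
    using G0 by (intro has_bochner_integral_nn_integral) (auto simp: f_def)
  then have "has_bochner_integral lborel f (2 *\<^sub>R G)"
    by (rule has_bochner_integral_even_function) (simp add: f_def)
  then have "has_bochner_integral lborel (\<lambda>x. 1 / sqrt (2 * pi) * f x) (1 / sqrt (2 * pi) *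
      (2 *\<^sub>R G))"
    by (rule has_bochner_integral_mult_right)
  then have "(\<integral>\<^sup>+x. ennreal (1 / sqrt (2 * pi) * f x) \<partial>lborel) =
      ennreal (1 / sqrt (2 * pi) * (2 *\<^sub>R G))"
    by (subst nn_integral_eq_integral) (auto simp: f_def has_bochner_integral_iff)
  moreover have "1 / sqrt (2 * pi) * f x = std_normal_density x * \<bar>x\<bar> powr p" for x
    by (simp add: f_def std_normal_density_def)
  moreover have "1 / sqrt (2 * pi) * (2 *\<^sub>R G) = 2 powr (p / 2) * Gamma ((p + 1) / 2) / sqrt pi"
  proof -
    have "2 powr ((p - 1) / 2) = 2 powr (p / 2) / sqrt 2"
      by (simp add: diff_divide_distrib powr_diff powr_half_sqrt)
    then have "1 / sqrt (2 * pi) * (2 *\<^sub>R G) =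
        2 * (2 powr (p / 2) * Gamma ((p + 1) / 2)) / (sqrt 2 * sqrt pi * sqrt 2)"
      by (simp add: G_def real_sqrt_mult)
    also have "sqrt 2 * sqrt pi * sqrt 2 = 2 * sqrt pi"
    proof -
      have "sqrt 2 * sqrt pi * sqrt 2 = (sqrt 2 * sqrt 2) * sqrt pi" by (simp only: mult_ac)
      then show ?thesis by simp
    qed
    finally show ?thesis by simp
  qed
  ultimately show ?thesis by (simp add: ennreal_mult)
qed

text \<open>The two exponents combine into that of a centred normal density with variance
  \<open>1 / (1 + b\<^sup>2)\<close>; its standard deviation \<open>s\<close> is the remaining
  factor.\<close>

lemma std_normal_exp_square:
  "(\<integral>\<^sup>+x. ennreal (std_normal_density x) * ennreal (exp (- (b * x)\<^sup>2 / 2)) \<partial>lborel) =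
      ennreal (1 / sqrt (1 + b\<^sup>2))"
proof -
  define s where "s = 1 / sqrt (1 + b\<^sup>2)"
  have pos: "1 + b\<^sup>2 > 0" by (simp add: add_pos_nonneg)
  have s: "s > 0" "s\<^sup>2 = 1 / (1 + b\<^sup>2)" using pos by (simp_all add: s_def power_divide)
  have "std_normal_density x * exp (- (b * x)\<^sup>2 / 2) = s * normal_density 0 s x" for x
  proof -
    have "- x\<^sup>2 / 2 + - (b * x)\<^sup>2 / 2 = - (x - 0)\<^sup>2 / (2 * s\<^sup>2)"
      unfolding s(2) by (simp add: field_simps power_mult_distrib)
    moreover have "1 / sqrt (2 * pi) = s * (1 / sqrt (2 * pi * s\<^sup>2))"
      using s(1) by (simp add: real_sqrt_mult)
    ultimately show ?thesis
      unfolding std_normal_density_def normal_density_def by (simp add: mult.assoc flip: exp_add)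
  qed
  then have "(\<integral>\<^sup>+x. ennreal (std_normal_density x) * ennreal (exp (- (b * x)\<^sup>2 / 2)) \<partial>lborel) =
      (\<integral>\<^sup>+x. ennreal (s * normal_density 0 s x) \<partial>lborel)"
    by (simp flip: ennreal_mult)
  also have "\<dots> = ennreal (\<integral>x. s * normal_density 0 s x \<partial>lborel)"
    using s by (intro nn_integral_eq_integral) auto
  also have "\<dots> = ennreal s" using s by simp
  finally show ?thesis by (simp add: s_def)
qed

text \<open>The logarithm of \<open>E \<bar>c\<eta>\<bar>\<^sup>p\<close> for a standard normal \<open>\<eta>\<close>. Its derivative at
  \<open>p = 0\<close> is \<open>E (ln \<bar>c\<eta>\<bar>)\<close>, and \<open>Digamma (1 / 2) = - \<gamma> - 2 ln 2\<close> is where the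
  Euler--Mascheroni constant enters.\<close>

definition log_abs_moment :: "real \<Rightarrow> real \<Rightarrow> real" where
  "log_abs_moment c p = p * ln \<bar>c\<bar> + p / 2 * ln 2 + ln_Gamma ((p + 1) / 2) - ln pi / 2"

lemma std_normal_scaled_abs_moment:
  assumes c: "c \<noteq> 0" and p: "p > -1"
  shows "(\<integral>\<^sup>+x. ennreal (std_normal_density x) * ennreal (\<bar>c * x\<bar> powr p) \<partial>lborel) =
      ennreal (exp (log_abs_moment c p))"
proof -
  have "(\<integral>\<^sup>+x. ennreal (std_normal_density x) * ennreal (\<bar>c * x\<bar> powr p) \<partial>lborel) =
      (\<integral>\<^sup>+x. ennreal (\<bar>c\<bar> powr p) * (ennreal (std_normal_density x) *
          ennreal (\<bar>x\<bar> powr p)) \<partial>lborel)"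
    by (intro nn_integral_cong) (simp add: abs_mult powr_mult ennreal_mult mult_ac)
  also have "\<dots> = ennreal (\<bar>c\<bar> powr p) * ennreal (2 powr (p / 2) * Gamma ((p + 1) / 2) / sqrt pi)"
    by (simp add: nn_integral_cmult std_normal_abs_moment[OF p])
  also have "\<dots> = ennreal (\<bar>c\<bar> powr p * (2 powr (p / 2) * Gamma ((p + 1) / 2) / sqrt pi))"
    using p by (subst ennreal_mult[symmetric]) auto
  also have "\<bar>c\<bar> powr p * (2 powr (p / 2) * Gamma ((p + 1) / 2) / sqrt pi) =
      exp (log_abs_moment c p)"
  proof -
    have "exp (ln pi / 2) = sqrt pi" by (simp add: powr_half_sqrt[symmetric] powr_def)
    then show ?thesis
      using c p by (simp add: log_abs_moment_def exp_add exp_diff Gamma_real_pos_exp powr_def)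
  qed
  finally show ?thesis .
qed

lemma log_abs_moment_0 [simp]: "log_abs_moment c 0 = 0"
  by (simp add: log_abs_moment_def ln_Gamma_real_pos Gamma_one_half_real ln_sqrt)

lemma log_abs_moment_deriv_0:
  assumes c: "c \<noteq> 0"
  shows "(log_abs_moment c has_real_derivative (ln (c\<^sup>2) - ln (2 *
      exp euler_mascheroni)) / 2) (at 0)"
proof -
  have "(log_abs_moment c has_real_derivative ln \<bar>c\<bar> + ln 2 / 2 + Digamma (1 / 2) * (1 / 2)) (at 0)"
    unfolding log_abs_moment_def[abs_def] by (auto intro!: derivative_eq_intros)
  moreover have "ln (c\<^sup>2) = 2 * ln \<bar>c\<bar>"
    using c ln_realpow[of "\<bar>c\<bar>" 2] by simp
  \<comment> \<open>The Digamma term contributes \<open>- \<gamma> / 2 - ln 2\<close>, which turns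
    \<open>ln 2 / 2\<close> into \<open>- ln 2 / 2\<close>.\<close>
  then have "ln \<bar>c\<bar> + ln 2 / 2 + Digamma (1 / 2) * (1 / 2) =
      (ln (c\<^sup>2) - ln (2 * exp euler_mascheroni)) / 2"
    by (simp add: Digamma_one_half ln_mult field_simps)
  ultimately show ?thesis by (simp only:)
qed

text \<open>The log-moment vanishes at 0 with negative slope, hence is negative just to the right of
  0.\<close>

lemma abs_moment_less_1_subcritical:
  assumes "c \<noteq> 0" "c\<^sup>2 < 2 * exp euler_mascheroni"
  obtains p where "p > 0" "exp (log_abs_moment c p) < 1"
proof -
  have "ln (c\<^sup>2) < ln (2 * exp euler_mascheroni)" using assms by simp
  then obtain d where d: "d > 0" "\<forall>h>0. h < d \<longrightarrow> log_abs_moment c (0 + h) < log_abs_moment c 0"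
    using DERIV_neg_dec_right[OF log_abs_moment_deriv_0[OF assms(1)]] by auto
  then have "log_abs_moment c (d / 2) < 0" by simp
  then show thesis using d(1) by (intro that[of "d / 2"]) auto
qed

text \<open>Now the slope at 0 is positive, so the log-moment is negative just to the left of
  0.\<close>

lemma abs_moment_less_1_supercritical:
  assumes "c\<^sup>2 > 2 * exp euler_mascheroni"
  obtains p where "p < 0" "p > -1" "exp (log_abs_moment c p) < 1"
proof -
  have pos: "(0::real) < 2 * exp euler_mascheroni" by simp
  with assms have c: "c \<noteq> 0" by auto
  have "ln (2 * exp euler_mascheroni) < ln (c\<^sup>2)" using assms pos c
    by (subst ln_less_cancel_iff) auto
  then obtain d where d: "d > 0" "\<forall>h>0. h < d \<longrightarrow> log_abs_moment c (0 - h) < log_abs_moment c 0"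
    using DERIV_pos_inc_left[OF log_abs_moment_deriv_0[OF c]] by auto
  \<comment> \<open>The cap 1/2 keeps the exponent \<open>- h\<close> above -1, where the moments
    are finite.\<close>
  define h where "h = min (d / 2) (1 / 2)"
  have "h > 0" "h < d" "h < 1" using d(1) by (auto simp: h_def)
  with d(2) show thesis by (intro that[of "- h"]) auto
qed

text \<open>The sum of the \<open>f n\<close> has finite integral, hence is finite almost
  everywhere, and the terms of a convergent series tend to 0.\<close>

lemma AE_tendsto_0_of_summable_nn_integral:
  fixes f :: "nat \<Rightarrow> 'a \<Rightarrow> ennreal"
  assumes [measurable]: "\<And>n. f n \<in> borel_measurable M" and fin: "(\<Sum>n. \<integral>\<^sup>+x. f n x \<partial>M) < \<top>"
  shows "AE x in M. (\<lambda>n. f n x) \<longlonglongrightarrow> 0"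
proof -
  have "(\<integral>\<^sup>+x. (\<Sum>n. f n x) \<partial>M) \<noteq> \<infinity>"
    using fin by (subst nn_integral_suminf) auto
  then have "AE x in M. (\<Sum>n. f n x) \<noteq> \<infinity>"
    by (intro nn_integral_PInf_AE) auto
  then show ?thesis
  proof eventually_elim
    case (elim x)
    have fx: "f n x = ennreal (enn2real (f n x))" for n
    proof -
      have "f n x \<le> (\<Sum>n. f n x)"
        using sum_le_suminf[of "\<lambda>n. f n x" "{n}"] by simp
      then show ?thesis using elim by (auto simp: top_unique ennreal_enn2real_if)
    qed
    have "summable (\<lambda>n. enn2real (f n x))"
      by (rule summable_suminf_not_top) (use elim in \<open>auto simp flip: fx\<close>)
    then have "(\<lambda>n. ennreal (enn2real (f n x))) \<longlonglongrightarrow> ennreal 0"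
      by (intro tendsto_ennrealI summable_LIMSEQ_zero)
    then show ?case by (simp flip: fx)
  qed
qed

section \<open>Independence and almost sure limits of products\<close>

context prob_space
begin

text \<open>Serves to single out a row or a column of the doubly indexed family
  \<open>eta\<close>.\<close>

lemma indep_sets_reindex:
  assumes h: "inj_on h J" and indep: "indep_sets F (h ` J)"
  shows "indep_sets (\<lambda>i. F (h i)) J"
proof (rule indep_setsI)
  show "F (h i) \<subseteq> events" if "i \<in> J" for i
    using indep that by (auto simp: indep_sets_def)
next
  fix A K assume K: "K \<noteq> {}" "K \<subseteq> J" "finite K" and A: "\<forall>j\<in>K. A j \<in> F (h j)"
  have hK: "inj_on h K" using h K(2) by (rule inj_on_subset)
  \<comment> \<open>The events \<open>A\<close> are moved to the indices \<open>h j\<close> by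
    inverting \<open>h\<close> on \<open>K\<close>.\<close>
  define B where "B = (\<lambda>x. A (inv_into K h x))"
  have B: "B (h j) = A j" if "j \<in> K" for j using hK that by (simp add: B_def)
  have "prob (\<Inter>x\<in>h ` K. B x) = (\<Prod>x\<in>h ` K. prob (B x))"
    using K A B by (intro indep_setsD[OF indep]) auto
  then show "prob (\<Inter>j\<in>K. A j) = (\<Prod>j\<in>K. prob (A j))"
    using hK B by (simp add: prod.reindex cong: INF_cong_simp)
qed

lemma indep_vars_reindex:
  assumes "inj_on h J" "indep_vars M' X (h ` J)"
  shows "indep_vars (\<lambda>i. M' (h i)) (\<lambda>i. X (h i)) J"
  using assms(2) indep_sets_reindex[OF assms(1)] unfolding indep_vars_def2 by auto

text \<open>Reduces the expectations of products below to one-dimensional Gaussian integrals; values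
  in \<open>ennreal\<close> avoid integrability side conditions.\<close>

lemma indep_vars_std_normal_prod:
  fixes X :: "'i \<Rightarrow> 'a \<Rightarrow> real" and g :: "'i \<Rightarrow> real \<Rightarrow> ennreal"
  assumes indep: "indep_vars (\<lambda>_. borel) X I" and J: "finite J" "J \<subseteq> I"
    and dist: "\<And>i. i \<in> J \<Longrightarrow> distributed M lborel (X i) std_normal_density"
    and [measurable]: "\<And>i. i \<in> J \<Longrightarrow> g i \<in> borel_measurable borel"
  shows "(\<integral>\<^sup>+\<omega>. (\<Prod>i\<in>J. g i (X i \<omega>)) \<partial>M) = (\<Prod>i\<in>J. \<integral>\<^sup>+x. ennreal (std_normal_density x) *
      g i x \<partial>lborel)"
proof -
  have "indep_vars (\<lambda>_. borel) (\<lambda>i \<omega>. g i (X i \<omega>)) J"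
    using indep_vars_subset[OF indep J(2)] by (rule indep_vars_compose2) simp
  then have "(\<integral>\<^sup>+\<omega>. (\<Prod>i\<in>J. g i (X i \<omega>)) \<partial>M) = (\<Prod>i\<in>J. \<integral>\<^sup>+\<omega>. g i (X i \<omega>) \<partial>M)"
    using J(1) by (intro indep_vars_nn_integral) auto
  also have "\<dots> = (\<Prod>i\<in>J. \<integral>\<^sup>+x. ennreal (std_normal_density x) * g i x \<partial>lborel)"
    by (intro prod.cong refl distributed_nn_integral[symmetric] dist) auto
  finally show ?thesis .
qed

text \<open>By independence the \<open>p\<close>-th power of the product has expectation
  \<open>\<rho> ^ n\<close> with \<open>\<rho> < 1\<close>, which is summable. Both signs of
  \<open>p\<close> are covered.\<close>

lemma AE_std_normal_prod_powr_tendsto_0: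
  fixes X :: "nat \<Rightarrow> 'a \<Rightarrow> real"
  assumes indep: "indep_vars (\<lambda>_. borel) X {1..}"
    and dist: "\<And>n. n \<ge> 1 \<Longrightarrow> distributed M lborel (X n) std_normal_density"
    and c: "c \<noteq> 0" and p: "p > -1" "exp (log_abs_moment c p) < 1"
  shows "AE \<omega> in M. (\<lambda>n. (\<Prod>j=1..n. \<bar>c * X j \<omega>\<bar>) powr p) \<longlonglongrightarrow> 0"
proof -
  define \<rho> where "\<rho> = exp (log_abs_moment c p)"
  define f where "f n \<omega> = (\<Prod>j=1..n. ennreal (\<bar>c * X j \<omega>\<bar> powr p))" for n \<omega>
  have [measurable]: "X n \<in> borel_measurable M" if "n \<ge> 1" for n
    using dist[OF that] by (auto simp: distributed_def)
  have meas: "f n \<in> borel_measurable M" for n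
    unfolding f_def by (rule borel_measurable_prod_ennreal) simp
  have "(\<integral>\<^sup>+\<omega>. f n \<omega> \<partial>M) = (\<Prod>j=1..n. ennreal \<rho>)" for n
  proof -
    have "(\<integral>\<^sup>+\<omega>. f n \<omega> \<partial>M) =
        (\<Prod>j=1..n. \<integral>\<^sup>+x. ennreal (std_normal_density x) * ennreal (\<bar>c * x\<bar> powr p) \<partial>lborel)"
      unfolding f_def by (rule indep_vars_std_normal_prod[OF indep]) (auto intro: dist)
    then show ?thesis by (simp only: std_normal_scaled_abs_moment[OF c p(1)] \<rho>_def)
  qed
  then have "(\<integral>\<^sup>+\<omega>. f n \<omega> \<partial>M) = ennreal (\<rho> ^ n)" for n
    by (simp add: ennreal_power \<rho>_def)
  moreover have "(\<Sum>n. ennreal (\<rho> ^ n)) < \<top>"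
    using p(2) by (subst suminf_ennreal2) (auto simp: \<rho>_def intro!: summable_geometric)
  ultimately have "AE \<omega> in M. (\<lambda>n. f n \<omega>) \<longlonglongrightarrow> 0"
    by (intro AE_tendsto_0_of_summable_nn_integral meas) simp
  moreover have "f n \<omega> = ennreal ((\<Prod>j=1..n. \<bar>c * X j \<omega>\<bar>) powr p)" for n \<omega>
    unfolding f_def by (subst prod_ennreal) (auto simp: prod_powr_distrib)
  ultimately show ?thesis
    by (simp add: tendsto_ennreal_iff[where x = 0, simplified])
qed

lemma AE_std_normal_prod_tendsto_0:
  fixes X :: "nat \<Rightarrow> 'a \<Rightarrow> real"
  assumes indep: "indep_vars (\<lambda>_. borel) X {1..}"
    and dist: "\<And>n. n \<ge> 1 \<Longrightarrow> distributed M lborel (X n) std_normal_density"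
    and c: "c\<^sup>2 < 2 * exp euler_mascheroni"
  shows "AE \<omega> in M. (\<lambda>n. \<Prod>j=1..n. \<bar>c * X j \<omega>\<bar>) \<longlonglongrightarrow> 0"
proof (cases "c = 0")
  case True
  have "eventually (\<lambda>n. (\<Prod>j=1..n. \<bar>c * X j \<omega>\<bar>) = 0) sequentially" for \<omega>
    using eventually_ge_at_top[of 1] by eventually_elim (use True in auto)
  then show ?thesis by (intro AE_I2 tendsto_eventually)
next
  case False
  then obtain p where p: "p > 0" "exp (log_abs_moment c p) < 1"
    using abs_moment_less_1_subcritical c by blast
  then have "AE \<omega> in M. (\<lambda>n. (\<Prod>j=1..n. \<bar>c * X j \<omega>\<bar>) powr p) \<longlonglongrightarrow> 0"
    by (intro AE_std_normal_prod_powr_tendsto_0[OF indep dist False]) auto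
  then show ?thesis
  proof eventually_elim
    case (elim \<omega>)
    have "(\<lambda>n. ((\<Prod>j=1..n. \<bar>c * X j \<omega>\<bar>) powr p) powr (1 / p)) \<longlonglongrightarrow> 0"
      by (rule tendsto_zero_powrI[OF elim tendsto_const]) (use p(1) in \<open>auto intro: prod_nonneg\<close>)
    then show ?case using p(1) by (simp add: powr_powr prod_nonneg)
  qed
qed

lemma AE_std_normal_nonzero:
  assumes "distributed M lborel X std_normal_density"
  shows "AE \<omega> in M. X \<omega> \<noteq> 0"
proof -
  have "(\<integral>\<^sup>+\<omega>. indicator {0} (X \<omega>) \<partial>M) = (\<integral>\<^sup>+x. ennreal (std_normal_density x) *
      indicator {0::real} x \<partial>lborel)"
    by (rule distributed_nn_integral[OF assms, symmetric]) simp
  also have "\<dots> = 0" by (simp add: nn_integral_indicator_singleton)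
  finally have "AE \<omega> in M. indicator {0} (X \<omega>) = (0::ennreal)"
    using distributed_measurable[OF assms] by (subst (asm) nn_integral_0_iff_AE) auto
  then show ?thesis by eventually_elim (auto simp: indicator_def split: if_splits)
qed

lemma AE_std_normal_prod_at_top:
  fixes X :: "nat \<Rightarrow> 'a \<Rightarrow> real"
  assumes indep: "indep_vars (\<lambda>_. borel) X {1..}"
    and dist: "\<And>n. n \<ge> 1 \<Longrightarrow> distributed M lborel (X n) std_normal_density"
    and c: "c\<^sup>2 > 2 * exp euler_mascheroni"
  shows "AE \<omega> in M. filterlim (\<lambda>n. \<Prod>j=1..n. \<bar>c * X j \<omega>\<bar>) at_top sequentially"
proof -
  have "(0::real) < 2 * exp euler_mascheroni" by simp
  with c have c0: "c \<noteq> 0" by auto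
  obtain p where p: "p < 0" "p > -1" "exp (log_abs_moment c p) < 1"
    using abs_moment_less_1_supercritical[OF c] by blast
  have "AE \<omega> in M. (\<lambda>n. (\<Prod>j=1..n. \<bar>c * X j \<omega>\<bar>) powr p) \<longlonglongrightarrow> 0"
    by (intro AE_std_normal_prod_powr_tendsto_0[OF indep dist c0] p)
  \<comment> \<open>Since \<open>0 powr p = 0\<close> also for negative \<open>p\<close>, a
    vanishing factor would let the powers tend to 0 without any growth of the products.\<close>
  moreover have "AE \<omega> in M. \<forall>n. n \<ge> 1 \<longrightarrow> X n \<omega> \<noteq> 0"
  proof (subst AE_all_countable, intro allI)
    show "AE \<omega> in M. n \<ge> 1 \<longrightarrow> X n \<omega> \<noteq> 0" for n
      using AE_std_normal_nonzero[OF dist, of n] by (cases "n \<ge> 1") auto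
  qed
  ultimately show ?thesis
  proof eventually_elim
    case (elim \<omega>)
    let ?Y = "\<lambda>n. \<Prod>j=1..n. \<bar>c * X j \<omega>\<bar>"
    have Y: "?Y n > 0" for n using elim(2) c0 by (intro prod_pos) auto
    show ?case
    unfolding filterlim_at_top_gt[where c = 0]
    proof (intro allI impI)
      \<comment> \<open>As \<open>p < 0\<close>, the map \<open>\<lambda>t. t powr p\<close> is
        decreasing on positive reals: a power below \<open>Z powr p\<close> forces a product above
        \<open>Z\<close>.\<close>
      fix Z :: real assume Z: "Z > 0"
      have "eventually (\<lambda>n. ?Y n powr p < Z powr p) sequentially"
        using elim(1) by (rule order_tendstoD) (use Z in simp)
      then show "eventually (\<lambda>n. Z \<le> ?Y n) sequentially"
      proof eventually_elim
        case (elim n)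
        show ?case
        proof (rule ccontr)
          assume "\<not> Z \<le> ?Y n"
          then have "Z powr p \<le> ?Y n powr p" using Y[of n] p(1) by (intro powr_mono2') auto
          with elim show False by simp
        qed
      qed
    qed
  qed
qed

text \<open>Since \<open>E \<bar>\<eta>\<bar> \<le> 1\<close>, the \<open>n\<close>-th sum has expectation at most
  \<open>\<Sum>k. \<bar>lam k\<bar>\<^sup>n \<le> (1 / 2)^(n - 2) * (\<Sum>k. (lam k)\<^sup>2)\<close>.\<close>

lemma AE_std_normal_prod_sum_tendsto_0:
  fixes lam :: "'k::countable \<Rightarrow> real" and eta :: "nat \<Rightarrow> 'k \<Rightarrow> 'a \<Rightarrow> real"
  assumes indep: "indep_vars (\<lambda>_. borel) (\<lambda>(n, k). eta n k) ({1..} \<times> UNIV)"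
    and dist: "\<And>n k. n \<ge> 1 \<Longrightarrow> distributed M lborel (eta n k) std_normal_density"
    and T: "\<And>k. k \<in> T \<Longrightarrow> \<bar>lam k\<bar> \<le> 1 / 2"
    and fin: "(\<integral>\<^sup>+k. ennreal ((lam k)\<^sup>2) \<partial>count_space T) < \<top>"
  shows "AE \<omega> in M. (\<lambda>n. \<integral>\<^sup>+k. (\<Prod>j=1..n. ennreal \<bar>lam k * eta j k \<omega>\<bar>) \<partial>count_space T) \<longlonglongrightarrow> 0"
proof -
  define f where "f n \<omega> = (\<integral>\<^sup>+k. (\<Prod>j=1..n. ennreal \<bar>lam k * eta j k \<omega>\<bar>) \<partial>count_space T)" for n \<omega>
  have [measurable]: "eta n k \<in> borel_measurable M" if "n \<ge> 1" for n k
    using dist[OF that] by (auto simp: distributed_def)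
  have pm: "(\<lambda>\<omega>. \<Prod>j=1..n. ennreal \<bar>lam k * eta j k \<omega>\<bar>) \<in> borel_measurable M" for n k
    by (rule borel_measurable_prod_ennreal) simp
  have meas: "f n \<in> borel_measurable M" for n
  proof -
    interpret T: sigma_finite_measure "count_space T"
      by (rule sigma_finite_measure_count_space_countable) auto
    \<comment> \<open>Joint measurability follows from measurability for each \<open>k\<close>
      because the index set is countable.\<close>
    have "(\<lambda>x. \<Prod>j=1..n. ennreal \<bar>lam (snd x) * eta j (snd x) (fst x)\<bar>)
        \<in> borel_measurable (M \<Otimes>\<^sub>M count_space T)"
      by (rule measurable_compose_countable'[where I = T and g = snd and
            f = "\<lambda>k x. \<Prod>j=1..n. ennreal \<bar>lam k * eta j k (fst x)\<bar>"])
         (auto intro: measurable_compose[OF measurable_fst pm])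
    then show ?thesis
      unfolding f_def by (intro T.borel_measurable_nn_integral) (simp add: split_beta')
  qed
  have first: "(\<integral>\<^sup>+x. ennreal (std_normal_density x) * ennreal \<bar>c * x\<bar> \<partial>lborel) \<le> ennreal \<bar>c\<bar>" for c
  proof -
    \<comment> \<open>\<open>sqrt 2 / sqrt pi\<close> is the first absolute moment of a standard
      normal variable.\<close>
    have "sqrt 2 / sqrt pi \<le> 1" using pi_gt3 by (simp add: real_sqrt_le_mono)
    then have m: "(\<integral>\<^sup>+x. ennreal (std_normal_density x) * ennreal \<bar>x\<bar> \<partial>lborel) \<le> 1"
      using std_normal_abs_moment[of 1] by (simp add: powr_half_sqrt)
    have "(\<integral>\<^sup>+x. ennreal (std_normal_density x) * ennreal \<bar>c * x\<bar> \<partial>lborel) =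
        ennreal \<bar>c\<bar> * (\<integral>\<^sup>+x. ennreal (std_normal_density x) * ennreal \<bar>x\<bar> \<partial>lborel)"
      by (subst nn_integral_cmult[symmetric]) (auto simp: abs_mult ennreal_mult mult_ac)
    also have "\<dots> \<le> ennreal \<bar>c\<bar> * 1" by (intro mult_left_mono m) simp
    finally show ?thesis by simp
  qed
  have prod: "(\<integral>\<^sup>+\<omega>. (\<Prod>j=1..n. ennreal \<bar>lam k * eta j k \<omega>\<bar>) \<partial>M) \<le> ennreal (\<bar>lam k\<bar> ^ n)" for n k
  proof -
    have "indep_vars (\<lambda>_. borel) (\<lambda>n. eta n k) {1..}"
      using indep_vars_reindex[of "\<lambda>n. (n, k)", OF _ indep_vars_subset[OF indep]]
      by (auto simp: inj_on_def image_subset_iff)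
    then have "(\<integral>\<^sup>+\<omega>. (\<Prod>j=1..n. ennreal \<bar>lam k * eta j k \<omega>\<bar>) \<partial>M) =
        (\<Prod>j=1..n. \<integral>\<^sup>+x. ennreal (std_normal_density x) * ennreal \<bar>lam k * x\<bar> \<partial>lborel)"
      by (rule indep_vars_std_normal_prod) (auto intro: dist)
    also have "\<dots> \<le> (\<Prod>j=1..n. ennreal \<bar>lam k\<bar>)"
      by (intro prod_mono_ennreal first)
    finally show ?thesis by (simp add: ennreal_power)
  qed
  \<comment> \<open>The sums for \<open>n = 0\<close> and \<open>n = 1\<close> can have infinite
    expectation, hence the shift: two of the \<open>n + 2\<close> factors give the summable
    \<open>(lam k)\<^sup>2\<close>, the others the geometric decay.\<close>
  have "(\<integral>\<^sup>+\<omega>. f (n + 2) \<omega> \<partial>M) \<le> ennreal ((1 / 2) ^ n) *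
      (\<integral>\<^sup>+k. ennreal ((lam k)\<^sup>2) \<partial>count_space T)" for n
  proof -
    have "(\<integral>\<^sup>+\<omega>. f (n + 2) \<omega> \<partial>M) =
        (\<integral>\<^sup>+k. \<integral>\<^sup>+\<omega>. (\<Prod>j=1..n+2. ennreal \<bar>lam k * eta j k \<omega>\<bar>) \<partial>M \<partial>count_space T)"
      unfolding f_def by (rule nn_integral_count_space_nn_integral[OF _ pm]) auto
    also have "\<dots> \<le> (\<integral>\<^sup>+k. ennreal ((1 / 2) ^ n) * ennreal ((lam k)\<^sup>2) \<partial>count_space T)"
    proof (rule nn_integral_mono)
      fix k assume "k \<in> space (count_space T)"
      then have "\<bar>lam k\<bar> ^ n \<le> (1 / 2) ^ n" using T by (intro power_mono) auto
      then have "\<bar>lam k\<bar> ^ (n + 2) \<le> (1 / 2) ^ n * (lam k)\<^sup>2"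
        unfolding power_add power2_abs by (rule mult_right_mono) simp
      with prod[of k "n + 2"]
      show "(\<integral>\<^sup>+\<omega>. (\<Prod>j=1..n+2. ennreal \<bar>lam k * eta j k \<omega>\<bar>) \<partial>M) \<le>
          ennreal ((1 / 2) ^ n) * ennreal ((lam k)\<^sup>2)"
        by (simp add: ennreal_mult[symmetric] del: power_Suc) (meson ennreal_leI order_trans)
    qed
    finally show ?thesis by (simp add: nn_integral_cmult)
  qed
  then have "(\<Sum>n. \<integral>\<^sup>+\<omega>. f (n + 2) \<omega> \<partial>M) \<le>
      (\<Sum>n. ennreal ((1 / 2) ^ n) * (\<integral>\<^sup>+k. ennreal ((lam k)\<^sup>2) \<partial>count_space T))"
    by (intro suminf_le) auto
  also have "\<dots> = (\<Sum>n. ennreal ((1 / 2) ^ n)) * (\<integral>\<^sup>+k. ennreal ((lam k)\<^sup>2) \<partial>count_space T)"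
    by (rule ennreal_suminf_multc)
  also have "\<dots> < \<top>"
    using fin by (subst suminf_ennreal2) (auto intro!: summable_geometric
        ennreal_mult_less_top[THEN iffD2])
  finally have "AE \<omega> in M. (\<lambda>n. f (n + 2) \<omega>) \<longlonglongrightarrow> 0"
    by (intro AE_tendsto_0_of_summable_nn_integral meas)
  then show ?thesis
    by eventually_elim (simp only: f_def LIMSEQ_ignore_initial_segment LIMSEQ_offset[of _ 2])
qed

text \<open>The Laplace transform \<open>E (exp (- S / 2)) = \<Prod>k. 1 / sqrt (1 + c\<^sub>k\<^sup>2)\<close> of
  \<open>S = \<Sum>k. (c\<^sub>k X\<^sub>k)\<^sup>2\<close> would vanish if \<open>\<Sum>k. c\<^sub>k\<^sup>2\<close> were infinite.\<close>

lemma std_normal_square_sum_bounded: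
  fixes c :: "'k \<Rightarrow> real" and X :: "'k \<Rightarrow> 'a \<Rightarrow> real"
  assumes indep: "indep_vars (\<lambda>_. borel) X UNIV"
    and dist: "\<And>k. distributed M lborel (X k) std_normal_density"
    and bdd: "AE \<omega> in M. \<exists>B. \<forall>F. finite F \<longrightarrow> (\<Sum>k\<in>F. (c k * X k \<omega>)\<^sup>2) \<le> B"
  shows "\<exists>L. \<forall>F. finite F \<longrightarrow> (\<Sum>k\<in>F. (c k)\<^sup>2) \<le> L"
proof (rule ccontr)
  assume "\<not> ?thesis"
  then have "\<forall>m::nat. \<exists>F. finite F \<and> real m < (\<Sum>k\<in>F. (c k)\<^sup>2)" by (meson not_le)
  then obtain F where F: "\<And>m. finite (F m)" "\<And>m::nat. real m < (\<Sum>k\<in>F m. (c k)\<^sup>2)" by metis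
  have [measurable]: "X k \<in> borel_measurable M" for k
    using dist[of k] by (auto simp: distributed_def)
  \<comment> \<open>For fixed \<open>B\<close> an exponential Markov inequality bounds the
    probability that all the sums stay below \<open>B\<close>, once for each \<open>m\<close>; then
    \<open>m\<close> tends to infinity.\<close>
  have null: "AE \<omega> in M. \<not> (\<forall>m. (\<Sum>k\<in>F m. (c k * X k \<omega>)\<^sup>2) \<le> real B)" for B :: nat
  proof -
    let ?A = "{\<omega> \<in> space M. \<forall>m. (\<Sum>k\<in>F m. (c k * X k \<omega>)\<^sup>2) \<le> real B}"
    have [measurable]: "?A \<in> sets M" by measurable
    have bound: "emeasure M ?A \<le> ennreal (exp (real B / 2) * (1 / sqrt (real m)))" if m: "m > 0"
        for m
    proof -
      have ind: "indicator ?A \<omega> \<le> ennreal (exp (real B / 2)) * (\<Prod>k\<in>F m. ennreal (exp (- (c k *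
          X k \<omega>)\<^sup>2 / 2)))" for \<omega>
      proof (cases "\<omega> \<in> ?A")
        case True
        then have "(\<Sum>k\<in>F m. (c k * X k \<omega>)\<^sup>2) / 2 \<le> real B / 2" by auto
        then have "1 \<le> exp (real B / 2 + (\<Sum>k\<in>F m. - (c k * X k \<omega>)\<^sup>2 / 2))"
          by (simp add: sum_negf flip: sum_divide_distrib)
        then show ?thesis
          using True F(1) by (simp add: exp_add exp_sum prod_ennreal ennreal_mult[symmetric]
              prod_nonneg)
      qed simp
      have "emeasure M ?A = (\<integral>\<^sup>+\<omega>. indicator ?A \<omega> \<partial>M)" by simp
      also have "\<dots> \<le> (\<integral>\<^sup>+\<omega>. ennreal (exp (real B / 2)) * (\<Prod>k\<in>F m. ennreal (exp (- (c k *
          X k \<omega>)\<^sup>2 / 2))) \<partial>M)"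
        by (rule nn_integral_mono) (rule ind)
      also have "\<dots> = ennreal (exp (real B / 2)) * (\<integral>\<^sup>+\<omega>. (\<Prod>k\<in>F m. ennreal (exp (- (c k *
          X k \<omega>)\<^sup>2 / 2))) \<partial>M)"
        by (rule nn_integral_cmult) measurable
      also have "(\<integral>\<^sup>+\<omega>. (\<Prod>k\<in>F m. ennreal (exp (- (c k * X k \<omega>)\<^sup>2 / 2))) \<partial>M) =
          (\<Prod>k\<in>F m. \<integral>\<^sup>+x. ennreal (std_normal_density x) * ennreal (exp (- (c k *
              x)\<^sup>2 / 2)) \<partial>lborel)"
        by (rule indep_vars_std_normal_prod[OF indep F(1)]) (auto intro: dist)
      also have "\<dots> = ennreal (\<Prod>k\<in>F m. 1 / sqrt (1 + (c k)\<^sup>2))"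
        by (simp only: std_normal_exp_square) (subst prod_ennreal, auto)
      also have "(\<Prod>k\<in>F m. 1 / sqrt (1 + (c k)\<^sup>2)) = 1 / sqrt (\<Prod>k\<in>F m. 1 + (c k)\<^sup>2)"
      proof -
        have "(\<Prod>k\<in>G. 1 / sqrt (1 + (c k)\<^sup>2)) = 1 / sqrt (\<Prod>k\<in>G. 1 + (c k)\<^sup>2)" for G
          by (induction G rule: infinite_finite_induct) (simp_all add: real_sqrt_mult)
        then show ?thesis .
      qed
      also have "ennreal (1 / sqrt (\<Prod>k\<in>F m. 1 + (c k)\<^sup>2)) \<le> ennreal (1 / sqrt (real m))"
      proof -
        \<comment> \<open>The sum consists of some of the terms of the expanded product, and for
          \<open>F m\<close> it exceeds \<open>m\<close> by choice.\<close>
        have "(\<Sum>k\<in>G. (c k)\<^sup>2) \<le> (\<Prod>k\<in>G. 1 + (c k)\<^sup>2)" if "finite G" for G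
          using that
        proof (induction G)
          case (insert k G)
          have "1 \<le> (\<Prod>k\<in>G. 1 + (c k)\<^sup>2)" by (intro prod_ge_1) simp
          then have "(c k)\<^sup>2 * 1 \<le> (c k)\<^sup>2 * (\<Prod>k\<in>G. 1 + (c k)\<^sup>2)" by (intro mult_left_mono) auto
          with insert show ?case by (simp add: algebra_simps)
        qed simp
        from this[OF F(1)[of m]] F(2)[of m] have "real m \<le> (\<Prod>k\<in>F m. 1 + (c k)\<^sup>2)" by linarith
        then show ?thesis using m by (intro ennreal_leI frac_le) auto
      qed
      finally show ?thesis by (subst ennreal_mult) (auto simp: mult_left_mono)
    qed
    have "emeasure M ?A \<le> ennreal 0"
    proof (rule LIMSEQ_le_const)
      have "(\<lambda>m. exp (real B / 2) * (1 / sqrt (real m))) \<longlonglongrightarrow> exp (real B / 2) * 0"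
        by (intro tendsto_intros tendsto_divide_0[OF tendsto_const] filterlim_at_top_imp_at_infinity
              filterlim_compose[OF sqrt_at_top filterlim_real_sequentially])
      then show "(\<lambda>m. ennreal (exp (real B / 2) * (1 / sqrt (real m)))) \<longlonglongrightarrow> ennreal 0"
        by (intro tendsto_ennrealI) simp
      show "\<exists>N. \<forall>m\<ge>N. emeasure M ?A \<le> ennreal (exp (real B / 2) * (1 / sqrt (real m)))"
        using bound by (intro exI[of _ 1]) auto
    qed
    then have "?A \<in> null_sets M" by (auto simp: null_sets_def)
    then show ?thesis by (rule AE_I') auto
  qed
  \<comment> \<open>Every real bound lies below a natural number, so countably many null sets
    suffice.\<close>
  then have "AE \<omega> in M. \<forall>B::nat. \<not> (\<forall>m. (\<Sum>k\<in>F m. (c k * X k \<omega>)\<^sup>2) \<le> real B)"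
    by (subst AE_all_countable) blast
  with bdd have "AE \<omega> in M. False"
  proof eventually_elim
    case (elim \<omega>)
    then obtain B where "\<And>m. (\<Sum>k\<in>F m. (c k * X k \<omega>)\<^sup>2) \<le> B" using F(1) by blast
    moreover obtain B' :: nat where "B \<le> real B'" using real_arch_simple by blast
    ultimately have "\<forall>m. (\<Sum>k\<in>F m. (c k * X k \<omega>)\<^sup>2) \<le> real B'" by (meson order_trans)
    with elim show ?case by blast
  qed
  then show False by simp
qed

end

subsection \<open>The convolution chain\<close>

text \<open>The triangle inequality for finite sums passes to the limit; in \<open>ennreal\<close>
  the right-hand side may be infinite.\<close>

lemma norm_has_sum_le_nn_integral:
  fixes f :: "'k \<Rightarrow> 'b::real_normed_vector"
  assumes "(f has_sum s) UNIV"
  shows "ennreal (norm s) \<le> (\<integral>\<^sup>+k. ennreal (norm (f k)) \<partial>count_space UNIV)"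
proof (rule tendsto_upperbound)
  show "((\<lambda>F. ennreal (norm (sum f F))) \<longlongrightarrow> ennreal (norm s)) (finite_subsets_at_top UNIV)"
    using assms unfolding has_sum_def by (intro tendsto_ennrealI tendsto_norm)
  have "ennreal (norm (sum f F)) \<le> (\<integral>\<^sup>+k. ennreal (norm (f k)) \<partial>count_space UNIV)"
    if "finite F" for F
  proof -
    have "ennreal (norm (sum f F)) \<le> (\<Sum>k\<in>F. ennreal (norm (f k)))"
      by (simp add: norm_sum ennreal_leI)
    also have "\<dots> = (\<integral>\<^sup>+k. ennreal (norm (f k)) \<partial>count_space F)"
      using that by (simp add: nn_integral_count_space_finite)
    also have "\<dots> = (\<integral>\<^sup>+k. ennreal (norm (f k)) * indicator F k \<partial>count_space UNIV)"
      by (simp add: nn_integral_count_space_indicator)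
    also have "\<dots> \<le> (\<integral>\<^sup>+k. ennreal (norm (f k)) \<partial>count_space UNIV)"
      by (intro nn_integral_mono) (auto simp: indicator_def)
    finally show ?thesis .
  qed
  then show "eventually (\<lambda>F. ennreal (norm (sum f F)) \<le>
      (\<integral>\<^sup>+k. ennreal (norm (f k)) \<partial>count_space UNIV)) (finite_subsets_at_top UNIV)"
    by (intro eventually_finite_subsets_at_top_weakI) auto
qed simp

lemma norm_L2_inner_le:
  assumes v: "v \<in> L2D" and u: "u \<in> L2D" and bound: "\<And>x. norm (u x) \<le> b"
  shows "norm (L2_inner v u) \<le> b * (\<integral>x. norm (periodic_ext v x) \<partial>cube_measure)"
proof -
  note [measurable] = L2D_periodic_ext_measurable[OF u] L2D_periodic_ext_measurable[OF v]
  have b0: "0 \<le> b" using bound norm_ge_zero order_trans by blast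
  have "L2_inner v u = (LINT x:unit_cube|lborel. cnj (periodic_ext v x) * periodic_ext u x)"
    unfolding L2_inner_def set_lebesgue_integral_def
    by (intro Bochner_Integration.integral_cong) (auto simp: periodic_ext_unit_cube indicator_def)
  also have "\<dots> = (\<integral>x. cnj (periodic_ext v x) * periodic_ext u x \<partial>cube_measure)"
    by (rule set_integral_unit_cube) measurable
  finally have eq: "L2_inner v u = (\<integral>x. cnj (periodic_ext v x) * periodic_ext u x \<partial>cube_measure)" .
  have "norm (L2_inner v u) \<le> (\<integral>x. norm (periodic_ext v x) * b \<partial>cube_measure)"
    unfolding eq
  proof (rule Bochner_Integration.integral_norm_bound_integral)
    show int: "integrable cube_measure (\<lambda>x. norm (periodic_ext v x) * b)"
      using L2D_integrable[OF v] by simp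
    have le: "norm (cnj (periodic_ext v x) * periodic_ext u x) \<le> norm (periodic_ext v x) * b" for x
      using bound b0 by (auto simp: norm_mult periodic_ext_def intro!: mult_left_mono)
    then show "norm (cnj (periodic_ext v x) * periodic_ext u x) \<le>
        norm (periodic_ext v x) * b" for x .
    show "integrable cube_measure (\<lambda>x. cnj (periodic_ext v x) * periodic_ext u x)"
      using int by (rule Bochner_Integration.integrable_bound) (use le b0 in auto)
  qed
  then show ?thesis by (simp add: mult.commute)
qed

text \<open>A test function is integrable over the cube, so uniform bounds tending to 0 force its
  inner products to 0. The bound starts at \<open>n = 1\<close> because the initial state is merely
  square integrable and may be unbounded.\<close>

lemma L2_weakly_converges_0_uniform:
  assumes U: "\<And>n. U n \<in> L2D" and lim: "b \<longlonglongrightarrow> (0::ennreal)"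
    and bound: "\<And>n x. n \<ge> 1 \<Longrightarrow> ennreal (norm (U n x)) \<le> b n"
  shows "L2_weakly_converges U (\<lambda>x. 0)"
  unfolding L2_weakly_converges_def
proof (intro conjI allI ballI U)
  show "(\<lambda>x. 0) \<in> L2D" by (rule L2D_bounded[where B = 0]) auto
  fix v :: "'a field" assume v: "v \<in> L2D"
  let ?I = "\<integral>x. norm (periodic_ext v x) \<partial>cube_measure"
  \<comment> \<open>\<open>enn2real\<close> sends infinity to 0, so the real bound is valid only
    once \<open>b n\<close> is finite.\<close>
  have "eventually (\<lambda>n. b n < \<top>) sequentially"
    using lim by (rule order_tendstoD) simp
  then have "eventually (\<lambda>n. norm (L2_inner v (U n)) \<le> enn2real (b n) * ?I) sequentially"
    using eventually_ge_at_top[of 1]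
  proof eventually_elim
    case (elim n)
    have "norm (U n x) \<le> enn2real (b n)" for x
      using enn2real_mono[OF bound[OF elim(2), of x] elim(1)] by simp
    then show ?case by (rule norm_L2_inner_le[OF v U])
  qed
  moreover have "(\<lambda>n. enn2real (b n) * ?I) \<longlonglongrightarrow> 0"
    by (intro tendsto_mult_left_zero tendsto_enn2real) (simp_all add: lim)
  ultimately have "(\<lambda>n. L2_inner v (U n)) \<longlonglongrightarrow> 0"
    by (rule Lim_null_comparison)
  then show "(\<lambda>n. L2_inner v (U n)) \<longlonglongrightarrow> L2_inner v (\<lambda>x. 0)"
    by (simp add: L2_inner_def set_lebesgue_integral_def)
qed

section \<open>A single realisation of the chain, with \<open>a n k\<close> for
  \<open>lam k * eta n k \<omega>\<close>\<close>

context
  fixes u0 :: "'d::finite field" and xi :: "nat \<Rightarrow> 'd field" and a :: "nat \<Rightarrow> int ^ 'd \<Rightarrow> real"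
  assumes u0: "u0 \<in> L2D"
    and xi: "\<And>n. n \<ge> 1 \<Longrightarrow> L2_has_sum (\<lambda>k x. complex_of_real (a n k) * fourier_basis k x) (xi n)"
begin

lemma conv_chain_L2D: "conv_chain u0 xi n \<in> L2D"
proof (induction n)
  case (Suc n)
  have "xi (Suc n) \<in> L2D" using xi[of "Suc n"] by (simp add: L2_has_sum_def)
  with Suc show ?case by (simp add: convolution_L2D)
qed (simp add: u0)

lemma fourier_coeff_conv_chain_Suc:
  "fourier_coeff (conv_chain u0 xi (Suc n)) k =
    complex_of_real (a (Suc n) k) * fourier_coeff (conv_chain u0 xi n) k"
proof -
  have "xi (Suc n) \<in> L2D" using xi[of "Suc n"] by (simp add: L2_has_sum_def)
  then show ?thesis
    using conv_chain_L2D fourier_coeff_L2_has_sum[OF xi, of "Suc n" k]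
    by (simp add: fourier_coeff_convolution)
qed

lemma norm_fourier_coeff_conv_chain:
  "norm (fourier_coeff (conv_chain u0 xi n) k) = norm (fourier_coeff u0 k) * (\<Prod>j=1..n. \<bar>a j k\<bar>)"
proof (induction n)
  case (Suc n)
  then show ?case unfolding fourier_coeff_conv_chain_Suc by (simp add: norm_mult)
qed simp

text \<open>For \<open>n \<ge> 1\<close> the state is a convolution, so by
  \<open>convolution_L2_has_sum\<close> its Fourier series converges to it at every point.\<close>

lemma norm_conv_chain_le:
  assumes "n \<ge> 1"
  shows "ennreal (norm (conv_chain u0 xi n x)) \<le>
    (\<integral>\<^sup>+k. ennreal (norm (fourier_coeff (conv_chain u0 xi n) k)) \<partial>count_space UNIV)"
proof -
  obtain m where n: "n = Suc m" using assms by (cases n) auto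
  let ?f = "\<lambda>k. complex_of_real (a n k) * fourier_coeff (conv_chain u0 xi m) k * fourier_basis k x"
  have "(?f has_sum conv_chain u0 xi n x) UNIV"
    unfolding n conv_chain.simps by (rule convolution_L2_has_sum[OF conv_chain_L2D xi]) simp
  from norm_has_sum_le_nn_integral[OF this] show ?thesis
    unfolding n fourier_coeff_conv_chain_Suc by (simp add: norm_mult)
qed

end

section \<open>Almost sure limits of the coefficients and weak convergence\<close>

lemma norm_fourier_coeff_le:
  assumes "v \<in> L2D"
  shows "norm (fourier_coeff v k) \<le> L2_norm v"
  using bessel_inequality[OF assms, of "{k}"] by (auto intro: power2_le_imp_le)

text \<open>Divergence is claimed for modes with \<open>fourier_coeff u0 k \<noteq> 0\<close>, since
  a mode absent from \<open>u0\<close> almost surely stays zero along the whole chain.\<close>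

theorem theorem16:
  fixes M :: "'w measure"
    and C :: "'d::finite field \<Rightarrow> 'd field"
    and lam :: "int ^ 'd \<Rightarrow> real"
    and eta :: "nat \<Rightarrow> int ^ 'd \<Rightarrow> 'w \<Rightarrow> real"
    and xi :: "nat \<Rightarrow> 'w \<Rightarrow> 'd field"
    and u0 :: "'d field"
    and u :: "nat \<Rightarrow> 'w \<Rightarrow> 'd field"
  assumes "prob_space M"
    and "L2_bounded_operator C"
    and "negative_fractional_power_of_diffop C"
    and "L2_positive C"
    and "L2_symmetric C"
    and "L2_positive_trace_class C"
    and "\<And>k. AE_eq (C (fourier_basis k)) (\<lambda>x. complex_of_real ((lam k)\<^sup>2) * fourier_basis k x)"
    and "iid_KL_gaussian M lam eta xi"
    and "u0 \<in> L2D"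
    and "\<And>n \<omega>. u n \<omega> = conv_chain u0 (\<lambda>m. xi m \<omega>) n"
  shows "(\<forall>k.
            (\<bar>lam k\<bar>\<^sup>2 < 2 * exp euler_mascheroni \<longrightarrow>
               (AE \<omega> in M. (\<lambda>n. (norm (fourier_coeff (u n \<omega>) k))\<^sup>2) \<longlonglongrightarrow> 0)) \<and>
            (\<bar>lam k\<bar>\<^sup>2 > 2 * exp euler_mascheroni \<and> fourier_coeff u0 k \<noteq> 0 \<longrightarrow>
               (AE \<omega> in M.
                  filterlim (\<lambda>n. (norm (fourier_coeff (u n \<omega>) k))\<^sup>2) at_top sequentially))) \<and>
         ((\<forall>k. \<bar>lam k\<bar>\<^sup>2 < 2 * exp euler_mascheroni) \<longrightarrow>
            (AE \<omega> in M. \<forall>k. (\<lambda>n. fourier_coeff (u n \<omega>) k) \<longlonglongrightarrow> 0) \<and>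
            (AE \<omega> in M. L2_weakly_converges (\<lambda>n. u n \<omega>) (\<lambda>x. 0)))"
proof -
  interpret prob_space M by fact
  note u0 = assms(9) and u = assms(10)
  have indep: "indep_vars (\<lambda>_. borel) (\<lambda>(n, k). eta n k) ({1..} \<times> UNIV)"
    and dist: "\<And>n k. n \<ge> 1 \<Longrightarrow> distributed M lborel (eta n k) std_normal_density"
    and sum: "\<And>n. n \<ge> 1 \<Longrightarrow>
      AE \<omega> in M. L2_has_sum (\<lambda>k x. complex_of_real (lam k * eta n k \<omega>) *
          fourier_basis k x) (xi n \<omega>)"
    using assms(8) unfolding iid_KL_gaussian_def by blast+
  have indep_n: "indep_vars (\<lambda>_. borel) (\<lambda>n. eta n k) {1..}" for k
    using indep_vars_reindex[of "\<lambda>n. (n, k)", OF _ indep_vars_subset[OF indep]]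
    by (auto simp: inj_on_def image_subset_iff)
  have indep_k: "indep_vars (\<lambda>_. borel) (eta 1) UNIV"
    using indep_vars_reindex[of "\<lambda>k. (1, k)", OF _ indep_vars_subset[OF indep]]
    by (auto simp: inj_on_def image_subset_iff)
  \<comment> \<open>There are only countably many \<open>n\<close>, so almost surely all expansions
    hold at once; on such a realisation the deterministic facts about the chain apply.\<close>
  define good where "good \<omega> \<longleftrightarrow> (\<forall>n. n \<ge> 1 \<longrightarrow>
      L2_has_sum (\<lambda>k x. complex_of_real (lam k * eta n k \<omega>) * fourier_basis k x) (xi n \<omega>))" for \<omega>
  have AE_good: "AE \<omega> in M. good \<omega>"
    unfolding good_def by (subst AE_all_countable) (use sum in auto)
  have coeff: "norm (fourier_coeff (u n \<omega>) k) =
      norm (fourier_coeff u0 k) * (\<Prod>j=1..n. \<bar>lam k * eta j k \<omega>\<bar>)"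
    if "good \<omega>" for n k \<omega>
    unfolding u by (rule norm_fourier_coeff_conv_chain[OF u0]) (use that in \<open>simp add: good_def\<close>)
  have sub: "AE \<omega> in M. (\<lambda>n. norm (fourier_coeff (u n \<omega>) k)) \<longlonglongrightarrow> 0"
    if "\<bar>lam k\<bar>\<^sup>2 < 2 * exp euler_mascheroni" for k
  proof -
    have "AE \<omega> in M. (\<lambda>n. \<Prod>j=1..n. \<bar>lam k * eta j k \<omega>\<bar>) \<longlonglongrightarrow> 0"
      using that by (intro AE_std_normal_prod_tendsto_0[OF indep_n dist]) auto
    with AE_good show ?thesis
    proof eventually_elim
      case (elim \<omega>)
      show ?case unfolding coeff[OF elim(1)] by (rule tendsto_mult_right_zero[OF elim(2)])
    qed
  qed
  have super: "AE \<omega> in M. filterlim (\<lambda>n. norm (fourier_coeff (u n \<omega>) k)) at_top sequentially"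
    if "\<bar>lam k\<bar>\<^sup>2 > 2 * exp euler_mascheroni" "fourier_coeff u0 k \<noteq> 0" for k
  proof -
    have "AE \<omega> in M. filterlim (\<lambda>n. \<Prod>j=1..n. \<bar>lam k * eta j k \<omega>\<bar>) at_top sequentially"
      using that(1) by (intro AE_std_normal_prod_at_top[OF indep_n dist]) auto
    with AE_good show ?thesis
    proof eventually_elim
      case (elim \<omega>)
      have "filterlim (\<lambda>n. norm (fourier_coeff u0 k) * (\<Prod>j=1..n. \<bar>lam k *
          eta j k \<omega>\<bar>)) at_top sequentially"
        using that(2) by (intro filterlim_tendsto_pos_mult_at_top[OF tendsto_const _ elim(2)]) simp
      then show ?case by (simp only: coeff[OF elim(1)])
    qed
  qed
  have sup_bound: "\<exists>L. \<forall>F. finite F \<longrightarrow> (\<Sum>k\<in>F. (lam k)\<^sup>2) \<le> L"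
  proof (rule std_normal_square_sum_bounded[OF indep_k dist])
    show "AE \<omega> in M. \<exists>B. \<forall>F. finite F \<longrightarrow> (\<Sum>k\<in>F. (lam k * eta 1 k \<omega>)\<^sup>2) \<le> B"
      using sum[OF order_refl]
    proof eventually_elim
      case (elim \<omega>)
      then have "xi 1 \<omega> \<in> L2D" by (simp add: L2_has_sum_def)
      from bessel_inequality[OF this] show ?case
        unfolding fourier_coeff_L2_has_sum[OF elim] norm_of_real power2_abs by blast
    qed
  qed simp
  then obtain L where L: "\<And>F. finite F \<Longrightarrow> (\<Sum>k\<in>F. (lam k)\<^sup>2) \<le> L" by blast
  define T where "T = {k. \<bar>lam k\<bar> \<le> 1 / 2}"
  \<comment> \<open>Each index outside \<open>T\<close> contributes at least 1/4 to sums bounded by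
    \<open>L\<close>, so there are at most \<open>4 * L\<close> of them.\<close>
  have "finite (- T)"
  proof (rule finite_if_finite_subsets_card_bdd[THEN conjunct1])
    fix G assume G: "G \<subseteq> - T" "finite G"
    have "real (card G) * (1 / 4) = (\<Sum>k\<in>G. 1 / 4)" by simp
    also have "\<dots> \<le> (\<Sum>k\<in>G. (lam k)\<^sup>2)"
    proof (rule sum_mono)
      fix k assume "k \<in> G"
      then have "(1 / 2)\<^sup>2 \<le> \<bar>lam k\<bar>\<^sup>2" using G(1) by (intro power_mono) (auto simp: T_def)
      then show "1 / 4 \<le> (lam k)\<^sup>2" by (simp add: power2_eq_square)
    qed
    also have "\<dots> \<le> L" by (rule L[OF G(2)])
    finally show "card G \<le> nat \<lceil>4 * L\<rceil>" by linarith
  qed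
  have tail_fin: "(\<integral>\<^sup>+k. ennreal ((lam k)\<^sup>2) \<partial>count_space T) < \<top>"
  proof -
    have "(\<lambda>k. (lam k)\<^sup>2) summable_on T"
      by (rule nonneg_bdd_above_summable_on) (auto intro!: bdd_aboveI2[where M = L] L)
    then have "integrable (count_space T) (\<lambda>k. (lam k)\<^sup>2)"
      using abs_summable_equivalent[of "\<lambda>k. (lam k)\<^sup>2" T]
        by (simp add: Infinite_Set_Sum.abs_summable_on_def)
    then show ?thesis by (simp add: nn_integral_eq_integral)
  qed
  have all: "AE \<omega> in M. \<forall>k. (\<lambda>n. norm (fourier_coeff (u n \<omega>) k)) \<longlonglongrightarrow> 0"
    if "\<forall>k. \<bar>lam k\<bar>\<^sup>2 < 2 * exp euler_mascheroni"
    unfolding AE_all_countable using sub that by blast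
  have weak: "AE \<omega> in M. L2_weakly_converges (\<lambda>n. u n \<omega>) (\<lambda>x. 0)"
    if "\<forall>k. \<bar>lam k\<bar>\<^sup>2 < 2 * exp euler_mascheroni"
  proof -
    have "AE \<omega> in M. (\<lambda>n. \<integral>\<^sup>+k. (\<Prod>j=1..n. ennreal \<bar>lam k * eta j k \<omega>\<bar>) \<partial>count_space T) \<longlonglongrightarrow> 0"
      by (rule AE_std_normal_prod_sum_tendsto_0[OF indep dist _ tail_fin]) (auto simp: T_def)
    with AE_good all[OF that] show ?thesis
    proof eventually_elim
      case (elim \<omega>)
      have xi: "L2_has_sum (\<lambda>k x. complex_of_real (lam k * eta n k \<omega>) * fourier_basis k x) (xi n \<omega>)"
        if "n \<ge> 1" for n
        using elim(1) that unfolding good_def by blast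
      define c where "c n k = ennreal (norm (fourier_coeff (u n \<omega>) k))" for n k
      define P where "P n = (\<integral>\<^sup>+k. (\<Prod>j=1..n. ennreal \<bar>lam k * eta j k \<omega>\<bar>) \<partial>count_space T)" for n
      \<comment> \<open>\<open>b n\<close> dominates the sum of all coefficient moduli: the finitely
        many modes outside \<open>T\<close> are kept individually, and on \<open>T\<close> each
        coefficient of \<open>u0\<close> is replaced by its bound \<open>L2_norm u0\<close>.\<close>
      define b where "b n = (\<Sum>k\<in>- T. c n k) + ennreal (L2_norm u0) * P n" for n
      have c: "(\<lambda>n. c n k) \<longlonglongrightarrow> 0" for k
        unfolding c_def using tendsto_ennrealI[OF elim(2)[rule_format]] by simp
      have P: "(\<lambda>n. ennreal (L2_norm u0) * P n) \<longlonglongrightarrow> ennreal (L2_norm u0) * 0"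
        using elim(3) unfolding P_def by (intro ennreal_tendsto_cmult) auto
      have "b \<longlonglongrightarrow> (\<Sum>k\<in>- T. 0) + ennreal (L2_norm u0) * 0"
        unfolding b_def[abs_def] by (intro tendsto_add tendsto_sum c P)
      then have b: "b \<longlonglongrightarrow> 0" by simp
      have cP: "c n k \<le> ennreal (L2_norm u0) * (\<Prod>j=1..n. ennreal \<bar>lam k * eta j k \<omega>\<bar>)" for n k
      proof -
        have "(\<Prod>j=1..n. ennreal \<bar>lam k * eta j k \<omega>\<bar>) = ennreal (\<Prod>j=1..n. \<bar>lam k * eta j k \<omega>\<bar>)"
          by (rule prod_ennreal) simp
        moreover have "norm (fourier_coeff u0 k) * (\<Prod>j=1..n. \<bar>lam k * eta j k \<omega>\<bar>)
            \<le> L2_norm u0 * (\<Prod>j=1..n. \<bar>lam k * eta j k \<omega>\<bar>)"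
          by (intro mult_right_mono norm_fourier_coeff_le[OF u0] prod_nonneg) auto
        ultimately show ?thesis
          unfolding c_def coeff[OF elim(1)] by (simp add: prod_nonneg ennreal_leI
              flip: ennreal_mult)
      qed
      have "(\<integral>\<^sup>+k. c n k \<partial>count_space UNIV) \<le> b n" for n
      proof -
        have "(\<integral>\<^sup>+k. c n k \<partial>count_space UNIV) =
            (\<integral>\<^sup>+k. c n k * indicator (- T) k + c n k * indicator T k \<partial>count_space UNIV)"
          by (intro nn_integral_cong) (auto simp: indicator_def)
        also have "\<dots> = (\<integral>\<^sup>+k. c n k \<partial>count_space (- T)) + (\<integral>\<^sup>+k. c n k \<partial>count_space T)"
          by (subst nn_integral_add) (auto simp: nn_integral_count_space_indicator)
        also have "(\<integral>\<^sup>+k. c n k \<partial>count_space (- T)) = (\<Sum>k\<in>- T. c n k)"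
          using \<open>finite (- T)\<close> by (rule nn_integral_count_space_finite)
        also have "(\<integral>\<^sup>+k. c n k \<partial>count_space T) \<le> ennreal (L2_norm u0) * P n"
        proof -
          have "ennreal (L2_norm u0) * P n =
              (\<integral>\<^sup>+k. ennreal (L2_norm u0) * (\<Prod>j=1..n. ennreal \<bar>lam k * eta j k \<omega>\<bar>) \<partial>count_space T)"
            unfolding P_def by (rule nn_integral_cmult[symmetric]) simp
          then show ?thesis by (simp only:) (intro nn_integral_mono cP)
        qed
        finally show ?thesis by (simp add: b_def add_left_mono)
      qed
      moreover have "ennreal (norm (u n \<omega> x)) \<le> (\<integral>\<^sup>+k. c n k \<partial>count_space UNIV)" if "n \<ge> 1" for n x
        unfolding c_def u by (rule norm_conv_chain_le[OF u0 xi that])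
      ultimately have "ennreal (norm (u n \<omega> x)) \<le> b n" if "n \<ge> 1" for n x
        using that order_trans by blast
      moreover have "u n \<omega> \<in> L2D" for n
        unfolding u by (rule conv_chain_L2D[OF u0 xi])
      ultimately show ?case by (intro L2_weakly_converges_0_uniform[OF _ b])
    qed
  qed
  have "AE \<omega> in M. (\<lambda>n. (norm (fourier_coeff (u n \<omega>) k))\<^sup>2) \<longlonglongrightarrow> 0"
    if "\<bar>lam k\<bar>\<^sup>2 < 2 * exp euler_mascheroni" for k
    using sub[OF that]
  proof eventually_elim
    case (elim \<omega>)
    show ?case using tendsto_power[OF elim, of 2] by simp
  qed
  moreover have "AE \<omega> in M. filterlim (\<lambda>n. (norm (fourier_coeff (u n \<omega>) k))\<^sup>2) at_top sequentially"
    if "\<bar>lam k\<bar>\<^sup>2 > 2 * exp euler_mascheroni" "fourier_coeff u0 k \<noteq> 0" for k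
    using super[OF that] by eventually_elim (rule filterlim_pow_at_top, simp_all)
  moreover have "AE \<omega> in M. \<forall>k. (\<lambda>n. fourier_coeff (u n \<omega>) k) \<longlonglongrightarrow> 0"
    if "\<forall>k. \<bar>lam k\<bar>\<^sup>2 < 2 * exp euler_mascheroni"
    using all[OF that] by eventually_elim (simp add: tendsto_norm_zero_iff)
  ultimately show ?thesis using weak by blast
qed

end
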